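(* Let $G$ be a graph on $n$ vertices with $n\geq 90$. If $G$ is triangle-free and $\chi(G)\geq 4$, then $$e(G)\leq \left\lfloor\frac{(n-3)^2}{4}\right\rfloor+5,$$ with equality if and only if $G$ is isomorphic to a graph in $\mathcal{G}(n)$.
   Context: All graphs are finite, simple and undirected. $e(G)$ denotes the number of edges of $G$ and $\chi(G)$ its chromatic number. A graph is triangle-free if it contains no $K_3$ as a subgraph. The Grötzsch graph $\Gamma$ is the graph with 11 vertices $u_1,\dots,u_5,v_1,\dots,v_5,w$ and 20 edges: $u_iu_{i+1}$, $v_iu_{i-1}$, $v_iu_{i+1}$ and $v_iw$ for $i=1,\dots,5$ (indices modulo 5). $\mathcal{G}(n)$ denotes the family of $n$-vertex graphs obtained from $\Gamma$ by replacing each vertex $v_i$ ($i=1,\dots,5$) by a nonempty independent set $V_i$ and the vertex $w$ by a nonempty independent set $W$ (the vertices $u_1,\dots,u_5$ are kept as single vertices), where the sizes satisfy either $\sum_{i=1}^5|V_i|=\lfloor \frac{n-3}{2}\rfloor$ and $|W|=\lceil \frac{n-7}{2}\rceil$, or $\sum_{i=1}^5|V_i|=\lceil \frac{n-3}{2}\rceil$ and $|W|=\lfloor \frac{n-7}{2}\rfloor$. Two vertices belonging to different sets (each $u_i$ being regarded as a singleton set) are adjacent if and only if the corresponding original vertices of $\Gamma$ are adjacent; all the sets are pairwise disjoint. *)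

theory Defs
  imports Complex_Main "HOL-Library.Ramsey" "HOL-Library.Disjoint_Sets" "HOL-Library.Numeral_Type"
begin

record 'a graph =
  verts :: "'a set"
  edges :: "'a set set"

text \<open>\<open>nsets A 2\<close> is the set of two-element subsets of \<open>A\<close>, so there are no loops and no
  multiple edges.\<close>

definition simple_graph :: "'a graph \<Rightarrow> bool" where
  "simple_graph G \<longleftrightarrow> finite (verts G) \<and> edges G \<subseteq> nsets (verts G) 2"

definition graph_iso :: "'a graph \<Rightarrow> 'b graph \<Rightarrow> bool" where
  "graph_iso G H \<longleftrightarrow> (\<exists>f. bij_betw f (verts G) (verts H) \<and>
     (\<forall>x\<in>verts G. \<forall>y\<in>verts G. {x, y} \<in> edges G \<longleftrightarrow> {f x, f y} \<in> edges H))"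

definition subgraph :: "'a graph \<Rightarrow> 'a graph \<Rightarrow> bool" where
  "subgraph H G \<longleftrightarrow> simple_graph H \<and> verts H \<subseteq> verts G \<and> edges H \<subseteq> edges G"

definition complete_graph :: "nat \<Rightarrow> nat graph" where
  "complete_graph k = \<lparr>verts = {..<k}, edges = nsets {..<k} 2\<rparr>"

definition triangle_free :: "'a graph \<Rightarrow> bool" where
  "triangle_free G \<longleftrightarrow> \<not> (\<exists>H. subgraph H G \<and> graph_iso H (complete_graph 3))"

definition proper_colouring :: "'a graph \<Rightarrow> nat \<Rightarrow> ('a \<Rightarrow> nat) \<Rightarrow> bool" where
  "proper_colouring G k c \<longleftrightarrow> c ` verts G \<subseteq> {..<k} \<and>
     (\<forall>x\<in>verts G. \<forall>y\<in>verts G. {x, y} \<in> edges G \<longrightarrow> c x \<noteq> c y)"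

definition chromatic_number :: "'a graph \<Rightarrow> nat" where
  "chromatic_number G = (LEAST k. \<exists>c. proper_colouring G k c)"

text \<open>Arithmetic in the five-element numeral type is modulo 5, which gives the cyclic indices
  directly (the index 5 is the element 0).\<close>

datatype gvertex = U "5" | V "5" | W

definition grotzsch_graph :: "gvertex graph" where
  "grotzsch_graph = \<lparr>verts = UNIV,
     edges = (\<Union>i. {{U i, U (i + 1)}, {V i, U (i - 1)}, {V i, U (i + 1)}, {V i, W}})\<rparr>"

text \<open>Each vertex \<open>x\<close> of \<open>G\<close> is replaced by the set \<open>B x\<close>. This set is independent in the
  blow-up when the sets are disjoint and \<open>G\<close> is simple.\<close>

definition blow_up :: "'a graph \<Rightarrow> ('a \<Rightarrow> 'b set) \<Rightarrow> 'b graph" where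
  "blow_up G B = \<lparr>verts = (\<Union>x\<in>verts G. B x),
     edges = {{a, b} | a b x y. {x, y} \<in> edges G \<and> a \<in> B x \<and> b \<in> B y}\<rparr>"

text \<open>The size conditions are stated over the integers, with floors and ceilings of real
  quotients, to avoid truncated subtraction.\<close>

definition grotzsch_family :: "nat \<Rightarrow> 'b graph set" where
  "grotzsch_family n = {blow_up grotzsch_graph B | B.
     disjoint_family B \<and>
     (\<forall>x. finite (B x) \<and> B x \<noteq> {}) \<and>
     (\<forall>i. card (B (U i)) = 1) \<and>
     card (verts (blow_up grotzsch_graph B)) = n \<and>
     (int (\<Sum>i\<in>UNIV. card (B (V i))) = \<lfloor>(real n - 3) / 2\<rfloor> \<and>
        int (card (B W)) = \<lceil>(real n - 7) / 2\<rceil> \<or>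
      int (\<Sum>i\<in>UNIV. card (B (V i))) = \<lceil>(real n - 3) / 2\<rceil> \<and>
        int (card (B W)) = \<lfloor>(real n - 7) / 2\<rfloor>)}"

end

theory Submission
  imports Defs
begin

text \<open>Let \<open>v\<close> be a vertex of maximum degree \<open>D\<close> in a triangle-free graph \<open>G\<close> that has no proper
  3-colouring. The set \<open>A = N(v)\<close> is independent, so \<open>G - A\<close> is not bipartite: otherwise a third
  colour on \<open>A\<close> would finish a 3-colouring. Let \<open>C\<close> be a shortest odd cycle of \<open>G - A\<close>; it is induced
  and has length \<open>l = 2k - 1 \<ge> 5\<close>. Let \<open>R\<close> be the set of all other vertices. The edges that meet \<open>R\<close>
  are at most \<open>|R| D\<close>; the others are the \<open>l\<close> edges of \<open>C\<close> and the edges between \<open>A\<close> and \<open>C\<close>, of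
  which every vertex of \<open>A\<close> has at most \<open>(l - 1) / 2 = k - 1\<close>, since its neighbours on \<open>C\<close> form an
  independent set. Hence
  \<open>e(G) \<le> (n - D - l) D + (k - 1) D + l = (n - k - D) D + 2k - 1\<close>. For \<open>k = 3\<close> this is
  \<open>(n - 3 - D) D + 5 \<le> \<lfloor>(n - 3)\<^sup>2 / 4\<rfloor> + 5\<close>, and for \<open>D \<ge> 3\<close> every larger \<open>k\<close> gives
  strictly less (\<open>edges_bound_or_pentagon\<close>).\<close>

text \<open>In the case of equality no inequality loses anything: \<open>C\<close> is a pentagon \<open>u\<^sub>0, \<dots>, u\<^sub>4\<close>, the set
  \<open>R\<close> is independent and all its vertices have degree \<open>D = |A|\<close>, every vertex of \<open>A\<close> has exactly two
  neighbours on \<open>C\<close>, and \<open>D\<close> is \<open>(n - 3) / 2\<close> rounded down or up. So \<open>A\<close> falls into five classes, the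
  class \<open>i\<close> being attached to \<open>u\<^sub>i\<^sub>-\<^sub>1\<close> and \<open>u\<^sub>i\<^sub>+\<^sub>1\<close>. If class \<open>i\<close> is empty
  and no vertex of \<open>R\<close> is adjacent to \<open>u\<^sub>i\<close>, then \<open>G\<close> is 3-colourable (\<open>empty_cls_attach\<close>). When no
  vertex of \<open>R\<close> has a neighbour on \<open>C\<close>, the degree condition makes \<open>R\<close> complete to \<open>A\<close>, all
  five classes are nonempty, and \<open>G\<close> is the required blow-up (\<open>graph_iso_grotzsch_family\<close>).\<close>

text \<open>Vertices of \<open>R\<close> may nevertheless be adjacent to \<open>C\<close>, because the pentagon can be the wrong one.
  Such a vertex misses as many vertices of \<open>A\<close> as it has neighbours on \<open>C\<close>, that is at most two, so it
  is not adjacent to \<open>u\<^sub>k\<^sub>-\<^sub>1\<close> or \<open>u\<^sub>k\<^sub>+\<^sub>1\<close> for a class \<open>k\<close> with at least three vertices; one exists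
  since \<open>D > 10\<close>. With \<open>k = 0\<close> it follows that classes 2 and 3 are empty and classes 1 and 4
  are singletons \<open>{p}\<close> and \<open>{q}\<close>. Then \<open>G\<close> is a blow-up for the pentagon \<open>u\<^sub>0, p, u\<^sub>2, u\<^sub>3, q\<close>,
  where class 0 takes the place of \<open>R\<close>, and \<open>R \<union> {u\<^sub>1, u\<^sub>4}\<close> that of \<open>A\<close>
  (\<open>graph_iso_grotzsch_family_if_attached\<close>).\<close>

section \<open>Odd cycles and two-colourings\<close>

lemma relpow_converse_if_sym:
  assumes "sym E" "(x, y) \<in> E ^^ n"
  shows "(y, x) \<in> E ^^ n"
  using assms(2)
proof (induction n arbitrary: y)
  case 0
  then show ?case by simp
next
  case (Suc n)
  then obtain z where "(x, z) \<in> E ^^ n" "(z, y) \<in> E" by auto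
  then show ?case using Suc.IH assms(1) by (metis relpow_Suc_I2 symD)
qed

lemma relpow_add_I: "(x, y) \<in> E ^^ m \<Longrightarrow> (y, z) \<in> E ^^ n \<Longrightarrow> (x, z) \<in> E ^^ (m + n)"
  by (auto simp: relpow_add)

text \<open>Without odd closed walks, all walks from a fixed representative of a connected component to a
  given vertex have the same parity, and this parity changes along every edge.\<close>

lemma odd_closed_walk_if_not_two_colourable:
  fixes E :: "'a rel"
  assumes "sym E" and "\<nexists>c :: 'a \<Rightarrow> bool. \<forall>(x, y)\<in>E. c x \<noteq> c y"
  shows "\<exists>n x. odd n \<and> (x, x) \<in> E ^^ n"
proof (rule ccontr)
  assume no_odd: "\<not> ?thesis"
  define r where "r x = (SOME y. (y, x) \<in> E\<^sup>*)" for x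
  have r: "(r x, x) \<in> E\<^sup>*" for x
    unfolding r_def by (rule someI[of _ x]) simp
  have r_eq: "r x = r y" if "(x, y) \<in> E" for x y
  proof -
    have "(y, x) \<in> E" using that assms(1) by (meson symD)
    then have "(z, x) \<in> E\<^sup>* \<longleftrightarrow> (z, y) \<in> E\<^sup>*" for z
      using that by (meson rtrancl.rtrancl_into_rtrancl)
    then show ?thesis unfolding r_def by simp
  qed
  define c where "c x = (\<exists>n. even n \<and> (r x, x) \<in> E ^^ n)" for x
  have "\<forall>(x, y)\<in>E. c x \<noteq> c y"
  proof clarify
    fix x y assume xy: "(x, y) \<in> E" and eq: "c x = c y"
    have "\<exists>m n. even (m + n) \<and> (r x, x) \<in> E ^^ m \<and> (r y, y) \<in> E ^^ n"
    proof (cases "c x")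
      case True
      then show ?thesis using eq unfolding c_def by (metis even_add)
    next
      case False
      obtain m n where "(r x, x) \<in> E ^^ m" "(r y, y) \<in> E ^^ n"
        using r rtrancl_imp_relpow by metis
      moreover from this have "odd m" "odd n" using False eq unfolding c_def by auto
      ultimately show ?thesis by (metis odd_even_add)
    qed
    then obtain m n where mn: "even (m + n)" "(r x, x) \<in> E ^^ m" "(r x, y) \<in> E ^^ n"
      using r_eq[OF xy] by metis
    have "(r x, y) \<in> E ^^ (m + 1)" using mn(2) xy by auto
    moreover have "(y, r x) \<in> E ^^ n" using relpow_converse_if_sym[OF assms(1) mn(3)] .
    ultimately have "(r x, r x) \<in> E ^^ (m + 1 + n)" by (rule relpow_add_I)
    moreover have "odd (m + 1 + n)" using mn(1) by simp
    ultimately show False using no_odd by blast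
  qed
  then show False using assms(2) by blast
qed

lemma relpow_segment:
  assumes "\<And>k. i \<le> k \<Longrightarrow> k < j \<Longrightarrow> (f k, f (Suc k)) \<in> E" "i \<le> j"
  shows "(f i, f j) \<in> E ^^ (j - i)"
  using assms(2,1)
proof (induction j rule: dec_induct)
  case base
  then show ?case by simp
next
  case (step n)
  then have "(f i, f n) \<in> E ^^ (n - i)" "(f n, f (Suc n)) \<in> E" by simp_all
  then show ?case using step.hyps by (metis Suc_diff_le relpow_Suc_I)
qed

text \<open>The cycle is a shortest odd closed walk. A repeated vertex splits it into two closed walks, and a chord
  closes each of its two arcs; in both cases one of the two closed walks is odd and shorter.\<close>

lemma induced_odd_cycle_if_not_two_colourable:
  fixes E :: "'a rel"
  assumes "sym E" and "irrefl E" and "\<nexists>c :: 'a \<Rightarrow> bool. \<forall>(x, y)\<in>E. c x \<noteq> c y"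
  obtains l f where "odd l" "l \<ge> 3" "inj_on f {..<l}"
    "\<And>i j. i < l \<Longrightarrow> j < l \<Longrightarrow>
      (f i, f j) \<in> E \<longleftrightarrow> j = Suc i mod l \<or> i = Suc j mod l"
proof -
  define P where "P n \<longleftrightarrow> odd n \<and> (\<exists>x. (x, x) \<in> E ^^ n)" for n
  define l where "l = (LEAST n. P n)"
  have "\<exists>n. P n" unfolding P_def using odd_closed_walk_if_not_two_colourable[OF assms(1,3)] by blast
  then have "P l" unfolding l_def by (meson LeastI_ex)
  then obtain x where odd: "odd l" and x: "(x, x) \<in> E ^^ l" unfolding P_def by blast
  have short: "l \<le> n" if "odd n" "(y, y) \<in> E ^^ n" for n y
    unfolding l_def by (rule Least_le) (use that P_def in blast)
  obtain f where f: "f 0 = x" "f l = x" "\<And>i. i < l \<Longrightarrow> (f i, f (Suc i)) \<in> E"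
    using x unfolding relpow_fun_conv by blast
  have inner: "(f i, f j) \<in> E ^^ (j - i)" if "i \<le> j" "j \<le> l" for i j
    using relpow_segment[of i j f E] that f(3) by simp
  have outer: "(f j, f i) \<in> E ^^ (l - j + i)" if "i \<le> j" "j \<le> l" for i j
    using relpow_add_I[of "f j" "f l" "l - j" E "f i" i] inner[of j l] inner[of 0 i] that f(1,2)
    by simp
  have inj: "f i \<noteq> f j" if "i < j" "j < l" for i j
  proof
    assume eq: "f i = f j"
    have "(f i, f i) \<in> E ^^ (j - i)" "(f i, f i) \<in> E ^^ (l - j + i)"
      using inner[of i j] outer[of i j] that eq by simp_all
    moreover have "odd (j - i) \<or> odd (l - j + i)" using odd that by presburger
    ultimately have "l \<le> j - i \<or> l \<le> l - j + i" using short by blast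
    then show False using that by linarith
  qed
  have chord: "j = Suc i \<or> i = 0 \<and> Suc j = l" if "i < j" "j < l" "(f i, f j) \<in> E" for i j
  proof -
    have "(f j, f i) \<in> E" using that(3) assms(1) by (meson symD)
    then have "(f i, f i) \<in> E ^^ (j - i + 1)" "(f j, f j) \<in> E ^^ (l - j + i + 1)"
      using inner[of i j] outer[of i j] that by auto
    moreover have "odd (j - i + 1) \<or> odd (l - j + i + 1)" using odd that by presburger
    ultimately have "l \<le> j - i + 1 \<or> l \<le> l - j + i + 1" using short by blast
    then show ?thesis using that by linarith
  qed
  have "l \<noteq> 1" using x assms(2) by (auto simp: irrefl_def)
  then have "l \<ge> 3" using odd by presburger
  have edge: "(f i, f (Suc i mod l)) \<in> E" if "i < l" for i
  proof (cases "Suc i = l")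
    case True
    then show ?thesis using f(3)[OF that] f(1,2) by simp
  next
    case False
    then show ?thesis using f(3)[OF that] that by simp
  qed
  show thesis
  proof
    show "odd l" "l \<ge> 3" by fact+
    show "inj_on f {..<l}"
      by (rule inj_onI) (metis inj lessThan_iff linorder_neqE_nat)
    fix i j assume ij: "i < l" "j < l"
    show "(f i, f j) \<in> E \<longleftrightarrow> j = Suc i mod l \<or> i = Suc j mod l"
    proof
      assume e: "(f i, f j) \<in> E"
      then have e': "(f j, f i) \<in> E" using assms(1) by (meson symD)
      have "i \<noteq> j" using e assms(2) by (auto simp: irrefl_def)
      then consider "i < j" | "j < i" by linarith
      then show "j = Suc i mod l \<or> i = Suc j mod l"
      proof cases
        case 1
        then show ?thesis using chord[OF 1 ij(2) e] ij by auto
      next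
        case 2
        then show ?thesis using chord[OF 2 ij(1) e'] ij by auto
      qed
    next
      assume "j = Suc i mod l \<or> i = Suc j mod l"
      then show "(f i, f j) \<in> E" using edge ij assms(1) by (metis symD)
    qed
  qed
qed

text \<open>An independent set of a cycle is disjoint from its own rotation by one step, which gives at most
  half of the vertices, rounded down.\<close>

lemma card_independent_odd_cycle:
  assumes "odd l" "I \<subseteq> {..<l}" "\<And>i. i \<in> I \<Longrightarrow> Suc i mod l \<notin> I"
  shows "card I \<le> (l - 1) div 2"
proof -
  let ?s = "\<lambda>i. Suc i mod l"
  have fin: "finite I" using assms(2) finite_subset by blast
  have "inj_on ?s {..<l}"
    by (rule inj_onI) (auto simp: mod_Suc split: if_splits)
  then have "card (?s ` I) = card I" using assms(2) by (meson card_image inj_on_subset)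
  moreover have "I \<inter> ?s ` I = {}" using assms(3) by auto
  ultimately have "2 * card I = card (I \<union> ?s ` I)" using fin by (simp add: card_Un_disjoint)
  also have "I \<union> ?s ` I \<subseteq> {..<l}" using assms(2) by (auto intro!: mod_less_divisor)
  then have "card (I \<union> ?s ` I) \<le> l" using card_mono[of "{..<l}"] by fastforce
  finally show ?thesis using assms(1) by presburger
qed

section \<open>Triangle-free graphs\<close>

locale triangle_free_graph =
  fixes G :: "'a graph"
  assumes simple: "simple_graph G" and triangle_free: "triangle_free G"
begin

abbreviation adj :: "'a \<Rightarrow> 'a \<Rightarrow> bool" where
  "adj x y \<equiv> {x, y} \<in> edges G"

definition nbhd :: "'a \<Rightarrow> 'a set" where
  "nbhd x = {y. adj x y}"

lemma finite_verts [simp]: "finite (verts G)"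
  using simple by (simp add: simple_graph_def)

lemma edge_cases:
  assumes "e \<in> edges G"
  obtains x y where "e = {x, y}" "x \<noteq> y" "x \<in> verts G" "y \<in> verts G"
proof -
  have "e \<in> nsets (verts G) 2" using assms simple by (auto simp: simple_graph_def)
  then show thesis using that by (auto simp: nsets_def card_2_iff)
qed

lemma finite_edges [simp]: "finite (edges G)"
proof -
  have "edges G \<subseteq> Pow (verts G)" by (auto elim: edge_cases)
  then show ?thesis by (meson finite_Pow_iff finite_subset finite_verts)
qed

lemma adj_sym: "adj x y \<longleftrightarrow> adj y x"
  by (simp add: insert_commute)

lemma adj_irrefl [simp]: "{x} \<notin> edges G"
proof
  assume "{x} \<in> edges G"
  then show False by (rule edge_cases) auto
qed

lemma adj_verts:
  assumes "adj x y"
  shows "x \<in> verts G \<and> y \<in> verts G"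
  using assms by (rule edge_cases) (auto simp: doubleton_eq_iff)

lemma nbhd_subset: "nbhd x \<subseteq> verts G"
  unfolding nbhd_def using adj_verts by blast

lemma finite_nbhd [simp]: "finite (nbhd x)"
  by (rule finite_subset[OF nbhd_subset finite_verts])

lemma in_nbhd [simp]: "y \<in> nbhd x \<longleftrightarrow> adj x y"
  by (simp add: nbhd_def)

lemma no_triangle:
  assumes "adj x y" "adj y z"
  shows "\<not> adj x z"
proof
  assume xz: "adj x z"
  have dist: "x \<noteq> y" "y \<noteq> z" "x \<noteq> z" using assms xz by auto
  define T where "T = \<lparr>verts = {x, y, z}, edges = {{x, y}, {y, z}, {x, z}}\<rparr>"
  have "subgraph T G"
    unfolding subgraph_def simple_graph_def T_def
    using assms xz dist adj_verts by (auto simp: nsets_def card_2_iff)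
  moreover have "graph_iso T (complete_graph 3)"
    unfolding graph_iso_def
  proof (intro exI conjI)
    let ?f = "\<lambda>v. if v = x then 0 else if v = y then 1 else (2::nat)"
    have "{..<3} = {0, 1, 2::nat}" by auto
    then show "bij_betw ?f (verts T) (verts (complete_graph 3))"
      using dist by (auto simp: T_def complete_graph_def bij_betw_def inj_on_def)
    show "\<forall>a\<in>verts T. \<forall>b\<in>verts T.
        {a, b} \<in> edges T \<longleftrightarrow> {?f a, ?f b} \<in> edges (complete_graph 3)"
      using dist by (auto simp: T_def complete_graph_def nsets_def card_insert_if doubleton_eq_iff)
  qed
  ultimately show False using triangle_free by (auto simp: triangle_free_def)
qed

lemma card_nbhd: "card (nbhd x) = card {e \<in> edges G. x \<in> e}"
proof (rule bij_betw_same_card[of "\<lambda>y. {x, y}"])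
  show "bij_betw (\<lambda>y. {x, y}) (nbhd x) {e \<in> edges G. x \<in> e}"
  proof (rule bij_betw_imageI)
    show "inj_on (\<lambda>y. {x, y}) (nbhd x)" by (auto simp: inj_on_def doubleton_eq_iff)
    show "(\<lambda>y. {x, y}) ` nbhd x = {e \<in> edges G. x \<in> e}"
    proof
      show "{e \<in> edges G. x \<in> e} \<subseteq> (\<lambda>y. {x, y}) ` nbhd x"
      proof
        fix e assume "e \<in> {e \<in> edges G. x \<in> e}"
        then have "e \<in> edges G" "x \<in> e" by auto
        then obtain y where "e = {x, y}" by (metis edge_cases insertE insert_commute singletonD)
        then show "e \<in> (\<lambda>y. {x, y}) ` nbhd x" using \<open>e \<in> edges G\<close> by auto
      qed
    qed auto
  qed
qed

text \<open>An edge \<open>e\<close> has \<open>1 + [e \<subseteq> R] - [e \<inter> R = {}]\<close> ends in \<open>R\<close>; the identity is the sum over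
  all edges.\<close>

lemma sum_degrees:
  assumes "R \<subseteq> verts G"
  shows "(\<Sum>x\<in>R. card (nbhd x)) + card {e \<in> edges G. e \<inter> R = {}}
    = card (edges G) + card {e \<in> edges G. e \<subseteq> R}"
proof -
  have [simp]: "finite R" using finite_subset[OF assms] by simp
  have ends: "card (e \<inter> R) + of_bool (e \<inter> R = {}) = 1 + of_bool (e \<subseteq> R)"
    if "e \<in> edges G" for e
    using that by (elim edge_cases) (auto simp: Int_insert_left)
  have "(\<Sum>x\<in>R. card (nbhd x)) = (\<Sum>x\<in>R. \<Sum>e\<in>edges G. of_bool (x \<in> e))"
    by (simp add: card_nbhd Int_def of_bool_def sum.If_cases)
  also have "\<dots> = (\<Sum>e\<in>edges G. card (e \<inter> R))"
    by (subst sum.swap) (simp add: of_bool_def sum.If_cases Int_def conj_commute)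
  finally have "(\<Sum>x\<in>R. card (nbhd x)) + card {e \<in> edges G. e \<inter> R = {}}
    = (\<Sum>e\<in>edges G. card (e \<inter> R) + of_bool (e \<inter> R = {}))"
    by (simp add: sum.distrib of_bool_def sum.If_cases Int_def)
  also have "\<dots> = (\<Sum>e\<in>edges G. 1 + of_bool (e \<subseteq> R))"
    by (rule sum.cong) (auto simp: ends)
  also have "\<dots> = card (edges G) + card {e \<in> edges G. e \<subseteq> R}"
    unfolding sum.distrib by (simp add: of_bool_def sum.If_cases Int_def)
  finally show ?thesis .
qed

end

lemma chromatic_number_le_3I:
  assumes "proper_colouring G 3 c" shows "chromatic_number G \<le> 3"
  unfolding chromatic_number_def by (rule Least_le) (rule exI[of _ c], rule assms)

section \<open>The edge bound\<close>

lemma mult_le_quarter_square: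
  fixes p q :: int
  shows "p * q \<le> (p + q)\<^sup>2 div 4" and "p * q = (p + q)\<^sup>2 div 4 \<longleftrightarrow> \<bar>p - q\<bar> \<le> 1"
proof -
  have eq: "(p + q)\<^sup>2 = 4 * (p * q) + (p - q)\<^sup>2" by (simp add: power2_eq_square algebra_simps)
  show "p * q \<le> (p + q)\<^sup>2 div 4" unfolding eq by (simp add: pos_imp_zdiv_nonneg_iff)
  have "p * q = (p + q)\<^sup>2 div 4 \<longleftrightarrow> (p - q)\<^sup>2 div 4 = 0" unfolding eq by auto
  also have "\<dots> \<longleftrightarrow> (p - q)\<^sup>2 < 2\<^sup>2"
    using zero_le_power2[of "p - q"] by auto
  also have "\<dots> \<longleftrightarrow> \<bar>p - q\<bar> \<le> 1"
    using abs_le_square_iff[of 2 "p - q"] by auto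
  finally show "p * q = (p + q)\<^sup>2 div 4 \<longleftrightarrow> \<bar>p - q\<bar> \<le> 1" .
qed

lemma exhaust_5: "i = 0 \<or> i = 1 \<or> i = 2 \<or> i = 3 \<or> i = 4" for i :: 5
proof (cases i rule: bit1_cases)
  case (of_int z)
  then have "z = 0 \<or> z = 1 \<or> z = 2 \<or> z = 3 \<or> z = 4" by auto
  then show ?thesis using of_int by auto
qed

lemma numerals_mod_5 [simp]:
  "(5::5) = 0" "(6::5) = 1" "(7::5) = 2" "(8::5) = 3" "(-1::5) = 4" "(-2::5) = 3" "(-3::5) = 2" "(-4::5) = 1"
  by simp_all

lemma forall_5: "(\<forall>i::5. P i) \<longleftrightarrow> P 0 \<and> P 1 \<and> P 2 \<and> P 3 \<and> P 4"
  by (metis exhaust_5)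

lemma UNIV_5: "UNIV = {0, 1, 2, 3, 4 :: 5}"
  using exhaust_5 by blast

context triangle_free_graph
begin

text \<open>The neighbourhood of \<open>v\<close> is independent, so a two-colouring of the edges that avoid it would extend to
  a 3-colouring of \<open>G\<close> by one further colour.\<close>

lemma odd_cycle_outside_nbhd:
  assumes "\<nexists>c. proper_colouring G 3 c"
  obtains l f where "odd l" "l \<ge> 5" "inj_on f {..<l}" "f ` {..<l} \<subseteq> verts G - nbhd v"
    "\<And>i j. i < l \<Longrightarrow> j < l \<Longrightarrow> adj (f i) (f j) \<longleftrightarrow> j = Suc i mod l \<or> i = Suc j mod l"
proof -
  define E where "E = {(x, y). adj x y \<and> x \<notin> nbhd v \<and> y \<notin> nbhd v}"
  have "sym E" unfolding E_def sym_def by (auto simp: adj_sym)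
  moreover have "irrefl E" unfolding E_def irrefl_def by auto
  moreover have "\<nexists>c :: 'a \<Rightarrow> bool. \<forall>(x, y)\<in>E. c x \<noteq> c y"
  proof
    assume "\<exists>c :: 'a \<Rightarrow> bool. \<forall>(x, y)\<in>E. c x \<noteq> c y"
    then obtain c :: "'a \<Rightarrow> bool" where c: "c x \<noteq> c y" if "(x, y) \<in> E" for x y by blast
    have "proper_colouring G 3 (\<lambda>x. if x \<in> nbhd v then 2 else of_bool (c x))"
      unfolding proper_colouring_def
    proof (intro conjI ballI impI)
      fix x y assume xy: "adj x y"
      have "\<not> (x \<in> nbhd v \<and> y \<in> nbhd v)" using no_triangle[OF _ xy, of v] by auto
      moreover have "c x \<noteq> c y" if "x \<notin> nbhd v" "y \<notin> nbhd v"
        using c[of x y] xy that by (auto simp: E_def)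
      ultimately show "(if x \<in> nbhd v then 2 else of_bool (c x))
        \<noteq> (if y \<in> nbhd v then 2 else of_bool (c y) :: nat)" by auto
    qed auto
    then show False using assms by blast
  qed
  ultimately obtain l f where lf: "odd l" "l \<ge> 3" "inj_on f {..<l}" and
    E: "\<And>i j. i < l \<Longrightarrow> j < l \<Longrightarrow> (f i, f j) \<in> E \<longleftrightarrow> j = Suc i mod l \<or> i = Suc j mod l"
    by (rule induced_odd_cycle_if_not_two_colourable) blast
  have out: "f i \<in> verts G - nbhd v" if "i < l" for i
  proof -
    have "(f i, f (Suc i mod l)) \<in> E" using E[of i "Suc i mod l"] that by simp
    then show ?thesis using adj_verts by (auto simp: E_def)
  qed
  have adj: "adj (f i) (f j) \<longleftrightarrow> j = Suc i mod l \<or> i = Suc j mod l" if "i < l" "j < l" for i j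
    using E[OF that] out that by (simp add: E_def)
  have "l \<noteq> 3"
  proof
    assume "l = 3"
    then have "adj (f 0) (f 1)" "adj (f 1) (f 2)" "adj (f 0) (f 2)"
      using adj by (simp_all add: numeral_2_eq_2)
    then show False using no_triangle by blast
  qed
  then have "l \<ge> 5" using lf(1,2) by presburger
  then show thesis using that lf(1,3) adj out by blast
qed

lemma card_nbhd_odd_cycle:
  assumes "odd l" "\<And>i. i < l \<Longrightarrow> adj (f i) (f (Suc i mod l))"
  shows "card (nbhd a \<inter> f ` {..<l}) \<le> (l - 1) div 2"
proof -
  define I where "I = {i. i < l \<and> adj a (f i)}"
  have "nbhd a \<inter> f ` {..<l} = f ` I" by (auto simp: I_def)
  then have "card (nbhd a \<inter> f ` {..<l}) \<le> card I" by (simp add: I_def card_image_le)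
  also have "card I \<le> (l - 1) div 2"
  proof (rule card_independent_odd_cycle[OF assms(1)])
    fix i assume i: "i \<in> I"
    then have "adj (f i) (f (Suc i mod l))" using assms(2) by (simp add: I_def)
    then show "Suc i mod l \<notin> I" using no_triangle[of a "f i"] i by (auto simp: I_def)
  qed (auto simp: I_def)
  finally show ?thesis .
qed

text \<open>The three extra summands on the left measure what the estimate gives away: edges inside \<open>R\<close>,
  vertices of \<open>R\<close> below the maximum degree, and vertices of \<open>nbhd v\<close> with few neighbours on the cycle.
  Keeping them in the inequality makes the equality case immediate: all of them vanish.\<close>

lemma card_edges_le_max_degree_split:
  assumes max: "\<And>x. card (nbhd x) \<le> card (nbhd v)"
    and l: "odd l" "l \<ge> 5" "inj_on f {..<l}" "f ` {..<l} \<subseteq> verts G - nbhd v"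
      "\<And>i j. i < l \<Longrightarrow> j < l \<Longrightarrow> adj (f i) (f j) \<longleftrightarrow> j = Suc i mod l \<or> i = Suc j mod l"
    and R_def: "R = verts G - nbhd v - f ` {..<l}"
  shows "card (edges G) + card {e \<in> edges G. e \<subseteq> R}
      + (\<Sum>x\<in>R. card (nbhd v) - card (nbhd x))
      + (\<Sum>a\<in>nbhd v. (l - 1) div 2 - card (nbhd a \<inter> f ` {..<l}))
    \<le> card R * card (nbhd v) + card (nbhd v) * ((l - 1) div 2) + l"
proof -
  define C where "C = f ` {..<l}"
  define A where "A = nbhd v"
  have [simp]: "finite C" "finite A" by (simp_all add: C_def A_def)
  have RV: "R \<subseteq> verts G" and VR: "verts G = A \<union> C \<union> R"
    using l(4) nbhd_subset by (auto simp: R_def C_def A_def)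
  have A_indep: "\<not> adj a b" if "a \<in> A" "b \<in> A" for a b
    using no_triangle[of v a b] that by (auto simp: A_def)
  have dC: "card (nbhd a \<inter> C) \<le> (l - 1) div 2" for a
    unfolding C_def using card_nbhd_odd_cycle[OF l(1)] l(5) by simp
  define EC where "EC = (\<lambda>i. {f i, f (Suc i mod l)}) ` {..<l}"
  define EA where "EA = (\<Union>a\<in>A. (\<lambda>c. {a, c}) ` (nbhd a \<inter> C))"
  have fin: "finite EC" "finite EA" by (simp_all add: EC_def EA_def)
  have "{e \<in> edges G. e \<inter> R = {}} \<subseteq> EC \<union> EA"
  proof
    fix e assume "e \<in> {e \<in> edges G. e \<inter> R = {}}"
    then have e: "e \<in> edges G" "e \<inter> R = {}" by auto
    then obtain x y where xy: "e = {x, y}" "x \<in> verts G" "y \<in> verts G" by (metis edge_cases)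
    then have mem: "x \<in> A \<union> C" "y \<in> A \<union> C" using e(2) VR by auto
    have adj: "adj x y" "adj y x" using e(1) xy(1) adj_sym by auto
    show "e \<in> EC \<union> EA"
    proof (cases "x \<in> C \<and> y \<in> C")
      case True
      then obtain i j where ij: "i < l" "j < l" "x = f i" "y = f j" by (auto simp: C_def)
      then have "j = Suc i mod l \<or> i = Suc j mod l" using l(5)[of i j] adj by simp
      then have "e \<in> EC" using ij xy(1) by (auto simp: EC_def insert_commute)
      then show ?thesis by simp
    next
      case False
      then have "x \<in> A \<and> y \<in> C \<or> x \<in> C \<and> y \<in> A" using mem A_indep adj by auto
      then have "\<exists>a\<in>A. \<exists>c\<in>C. adj a c \<and> e = {a, c}"
        using adj xy(1) by (metis insert_commute)
      then obtain a c where "a \<in> A" "c \<in> C" "adj a c" "e = {a, c}" by blast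
      then have "a \<in> A" "e \<in> (\<lambda>c. {a, c}) ` (nbhd a \<inter> C)" by auto
      then have "e \<in> EA" unfolding EA_def by blast
      then show ?thesis by simp
    qed
  qed
  then have "card {e \<in> edges G. e \<inter> R = {}} \<le> card EC + card EA"
    using fin by (meson card_Un_le card_mono finite_UnI le_trans)
  also have "card EC \<le> l" unfolding EC_def using card_image_le[of "{..<l}"] by fastforce
  also have "card EA \<le> (\<Sum>a\<in>A. card ((\<lambda>c. {a, c}) ` (nbhd a \<inter> C)))"
    unfolding EA_def by (rule card_UN_le) simp
  also have "\<dots> \<le> (\<Sum>a\<in>A. card (nbhd a \<inter> C))"
    by (intro sum_mono card_image_le) simp
  finally have inner: "card {e \<in> edges G. e \<inter> R = {}} \<le> l + (\<Sum>a\<in>A. card (nbhd a \<inter> C))"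
    by simp
  have "(\<Sum>x\<in>R. card A - card (nbhd x)) + (\<Sum>x\<in>R. card (nbhd x)) = card R * card A"
    using max by (simp add: A_def flip: sum.distrib)
  moreover have "(\<Sum>a\<in>A. (l - 1) div 2 - card (nbhd a \<inter> C)) + (\<Sum>a\<in>A. card (nbhd a \<inter> C))
    = card A * ((l - 1) div 2)"
    using dC by (simp flip: sum.distrib)
  ultimately show ?thesis
    using inner sum_degrees[OF RV] unfolding A_def C_def by linarith
qed

text \<open>With \<open>D\<close> the maximum degree and \<open>2k - 1\<close> the length of the cycle, the previous lemma bounds the number
  of edges by \<open>D (n - 3 - D) + 5 - (k - 3) (D - 2)\<close>. For \<open>D \<ge> 3\<close>, equality forces \<open>k = 3\<close> and
  makes \<open>D\<close> and \<open>n - 3 - D\<close> differ by at most 1; for \<open>D \<le> 2\<close> there are at most \<open>n\<close> edges.\<close>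

lemma edges_bound_or_pentagon:
  assumes not_3col: "\<nexists>c. proper_colouring G 3 c" and n: "n = card (verts G)" "n \<ge> 10"
  defines "F \<equiv> (int n - 3)\<^sup>2 div 4 + 5"
  shows "int (card (edges G)) \<le> F"
    and "int (card (edges G)) = F \<Longrightarrow>
      \<exists>(u :: 5 \<Rightarrow> 'a) A R. verts G = range u \<union> A \<union> R \<and>
        range u \<inter> A = {} \<and> range u \<inter> R = {} \<and> A \<inter> R = {} \<and>
        (\<forall>i. adj (u i) (u (i + 1))) \<and> (\<forall>a\<in>A. \<forall>b\<in>A. \<not> adj a b) \<and>
        (\<forall>x\<in>R. \<forall>y\<in>R. \<not> adj x y) \<and> (\<forall>x\<in>R. card (nbhd x) = card A) \<and>
        (\<forall>a\<in>A. card (nbhd a \<inter> range u) = 2) \<and> \<bar>int (card A) - int (card R + 2)\<bar> \<le> 1"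
proof -
  have ne: "verts G \<noteq> {}" using n by auto
  have "Max ((\<lambda>x. card (nbhd x)) ` verts G) \<in> (\<lambda>x. card (nbhd x)) ` verts G"
    using ne by simp
  then obtain v where "card (nbhd v) = Max ((\<lambda>x. card (nbhd x)) ` verts G)" by auto
  then have "card (nbhd x) \<le> card (nbhd v)" if "x \<in> verts G" for x
    using that by simp
  moreover have "nbhd x = {}" if "x \<notin> verts G" for x using that adj_verts by auto
  ultimately have max: "card (nbhd x) \<le> card (nbhd v)" for x
    by (metis card.empty le0)
  define D where "D = card (nbhd v)"
  obtain l f where l: "odd l" "l \<ge> 5" "inj_on f {..<l}" "f ` {..<l} \<subseteq> verts G - nbhd v"
    "\<And>i j. i < l \<Longrightarrow> j < l \<Longrightarrow> adj (f i) (f j) \<longleftrightarrow> j = Suc i mod l \<or> i = Suc j mod l"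
    using odd_cycle_outside_nbhd[OF not_3col] by blast
  define R where "R = verts G - nbhd v - f ` {..<l}"
  define k where "k = (l + 1) div 2"
  have k: "l = 2 * k - 1" "k \<ge> 3" "(l - 1) div 2 = k - 1" using l(1,2) unfolding k_def by presburger+
  have "card (verts G) = card (nbhd v \<union> f ` {..<l} \<union> R)"
    using l(4) nbhd_subset by (intro arg_cong[of _ _ card]) (auto simp: R_def)
  also have "\<dots> = D + l + card R"
    using l(3,4) by (subst card_Un_disjoint; (subst card_Un_disjoint)?) 
      (auto simp: R_def D_def card_image)
  finally have card_R: "n = D + l + card R" using n by simp
  define slack where "slack = card {e \<in> edges G. e \<subseteq> R} + (\<Sum>x\<in>R. D - card (nbhd x))
      + (\<Sum>a\<in>nbhd v. (l - 1) div 2 - card (nbhd a \<inter> f ` {..<l}))"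
  have "card (edges G) + slack \<le> card R * D + D * (k - 1) + l"
    using card_edges_le_max_degree_split[OF max l R_def] k by (simp add: slack_def D_def)
  then have "int (card (edges G)) + int slack \<le> int (card R * D + D * (k - 1) + l)"
    by linarith
  also have "\<dots> = int D * (int n - 3 - int D) + 5 - (int k - 3) * (int D - 2)"
  proof -
    have eqs: "int (k - 1) = int k - 1" "int l = 2 * int k - 1" "int n = int D + int l + int (card R)"
      using k(1,2) card_R by simp_all
    show ?thesis unfolding of_nat_add of_nat_mult eqs by (simp add: algebra_simps)
  qed
  finally have main: "int (card (edges G)) + int slack
    \<le> int D * (int n - 3 - int D) + 5 - (int k - 3) * (int D - 2)" .
  have quarter: "int D * (int n - 3 - int D) \<le> (int n - 3)\<^sup>2 div 4"
    using mult_le_quarter_square(1)[of "int D" "int n - 3 - int D"] by simp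
  have small: "int (card (edges G)) < F" if "D \<le> 2"
  proof -
    have "(\<Sum>x\<in>verts G. card (nbhd x)) \<le> (\<Sum>x\<in>verts G. 2)"
      by (rule sum_mono) (use max that D_def in \<open>metis le_trans\<close>)
    moreover have none: "{e \<in> edges G. e \<inter> verts G = {}} = {}"
      "{e \<in> edges G. e \<subseteq> verts G} = edges G" by (auto elim: edge_cases)
    ultimately have "card (edges G) \<le> n"
      using sum_degrees[of "verts G"] n by (simp add: none)
    moreover have "4 * int n \<le> (int n - 3)\<^sup>2"
    proof (rule order_trans)
      show "4 * int n \<le> 7 * (int n - 3)" using n(2) by simp
      show "7 * (int n - 3) \<le> (int n - 3)\<^sup>2"
        using n(2) mult_right_mono[of 7 "int n - 3" "int n - 3"] by (simp add: power2_eq_square)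
    qed
    then have "4 * int n div 4 \<le> (int n - 3)\<^sup>2 div 4" by (rule zdiv_mono1) simp
    ultimately show ?thesis unfolding F_def by simp
  qed
  have long: "int (card (edges G)) < F" if "D \<ge> 3" "k > 3"
  proof -
    have "(int k - 3) * (int D - 2) > 0" using that by simp
    then show ?thesis using main quarter unfolding F_def by linarith
  qed
  show "int (card (edges G)) \<le> F"
    using small long main quarter k(2) unfolding F_def
    by (cases "D \<le> 2"; cases "k = 3") auto
  assume eq: "int (card (edges G)) = F"
  then have "D \<ge> 3" "k = 3" using small long k(2) by force+
  then have l5: "l = 5" and slack0: "slack = 0"
    and D: "int D * (int n - 3 - int D) = (int n - 3)\<^sup>2 div 4"
    using main quarter eq k(1) unfolding F_def by auto
  have fR: "finite R" by (simp add: R_def)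
  have R_indep: "\<not> adj x y" if "x \<in> R" "y \<in> R" for x y
  proof
    assume "adj x y"
    then have "{x, y} \<in> {e \<in> edges G. e \<subseteq> R}" using that by simp
    then show False using slack0 by (auto simp: slack_def)
  qed
  have deg_R: "card (nbhd x) = D" if "x \<in> R" for x
  proof -
    have "D - card (nbhd x) = 0" using slack0 fR that by (simp add: slack_def)
    then show ?thesis using max[of x] by (simp add: D_def)
  qed
  define u :: "5 \<Rightarrow> 'a" where
    "u i = (if i = 0 then f 0 else if i = 1 then f 1 else if i = 2 then f 2
      else if i = 3 then f 3 else f 4)" for i
  have u: "u 0 = f 0" "u 1 = f 1" "u 2 = f 2" "u 3 = f 3" "u 4 = f 4"
    by (simp_all add: u_def)
  have "range u = u ` {0, 1, 2, 3, 4}" by (simp only: UNIV_5)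
  also have "\<dots> = f ` {0, 1, 2, 3, 4}" by (simp add: u)
  also have "{0, 1, 2, 3, 4} = {..<l}" using l5 by auto
  finally have range: "range u = f ` {..<l}" .
  have cycle: "\<forall>i. adj (u i) (u (i + 1))"
    by (subst forall_5) (simp add: u l(5) l5 adj_sym)
  have two: "card (nbhd a \<inter> range u) = 2" if "a \<in> nbhd v" for a
  proof -
    have "2 - card (nbhd a \<inter> range u) = 0" using slack0 that l5 range by (simp add: slack_def)
    moreover have "card (nbhd a \<inter> range u) \<le> 2"
      using card_nbhd_odd_cycle[of l f a] l(1,5) l5 unfolding range by simp
    ultimately show ?thesis by simp
  qed
  have "\<bar>int D - (int n - 3 - int D)\<bar> \<le> 1"
    using D mult_le_quarter_square(2)[of "int D" "int n - 3 - int D"] by simp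
  then have balanced: "\<bar>int D - int (card R + 2)\<bar> \<le> 1" using card_R l5 by simp
  show "\<exists>(u :: 5 \<Rightarrow> 'a) A R. verts G = range u \<union> A \<union> R \<and>
        range u \<inter> A = {} \<and> range u \<inter> R = {} \<and> A \<inter> R = {} \<and>
        (\<forall>i. adj (u i) (u (i + 1))) \<and> (\<forall>a\<in>A. \<forall>b\<in>A. \<not> adj a b) \<and>
        (\<forall>x\<in>R. \<forall>y\<in>R. \<not> adj x y) \<and> (\<forall>x\<in>R. card (nbhd x) = card A) \<and>
        (\<forall>a\<in>A. card (nbhd a \<inter> range u) = 2) \<and> \<bar>int (card A) - int (card R + 2)\<bar> \<le> 1"
  proof (rule exI[of _ u], rule exI[of _ "nbhd v"], rule exI[of _ R], intro conjI)
    show "verts G = range u \<union> nbhd v \<union> R" using l(4) nbhd_subset unfolding range R_def by auto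
    show "range u \<inter> nbhd v = {}" "range u \<inter> R = {}" "nbhd v \<inter> R = {}"
      using l(4) unfolding range R_def by auto
    show "\<forall>a\<in>nbhd v. \<forall>b\<in>nbhd v. \<not> adj a b" using no_triangle[of v] by auto
  qed (use cycle R_indep deg_R two balanced D_def in auto)
qed

end

section \<open>Pentagon splits\<close>

lemma grotzsch_edges [simp]:
  "{U i, U j} \<in> edges grotzsch_graph \<longleftrightarrow> j = i + 1 \<or> i = j + 1"
  "{U i, V j} \<in> edges grotzsch_graph \<longleftrightarrow> i = j + 1 \<or> i = j - 1"
  "{V j, U i} \<in> edges grotzsch_graph \<longleftrightarrow> i = j + 1 \<or> i = j - 1"
  "{V i, V j} \<notin> edges grotzsch_graph"
  "{V i, W} \<in> edges grotzsch_graph" "{W, V i} \<in> edges grotzsch_graph"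
  "{U i, W} \<notin> edges grotzsch_graph" "{W, U i} \<notin> edges grotzsch_graph"
  "{W} \<notin> edges grotzsch_graph" "{U i} \<notin> edges grotzsch_graph" "{V i} \<notin> edges grotzsch_graph"
  by (auto simp: grotzsch_graph_def doubleton_eq_iff)

text \<open>A graph whose adjacency depends only on the images of the vertices under a map \<open>cl\<close> into \<open>H\<close> is a
  blow-up of \<open>H\<close> by the fibres of \<open>cl\<close>. The injection \<open>h\<close> moves the copy to another vertex type.\<close>

lemma graph_iso_blow_up_classes:
  assumes inj: "inj_on h (verts G)" and H: "\<And>x. x \<in> verts G \<Longrightarrow> cl x \<in> verts H"
    and adj: "\<And>x y. x \<in> verts G \<Longrightarrow> y \<in> verts G \<Longrightarrow>
      {x, y} \<in> edges G \<longleftrightarrow> {cl x, cl y} \<in> edges H"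
  shows "graph_iso G (blow_up H (\<lambda>c. h ` {x \<in> verts G. cl x = c}))"
  unfolding graph_iso_def
proof (intro exI conjI ballI)
  show "bij_betw h (verts G) (verts (blow_up H (\<lambda>c. h ` {x \<in> verts G. cl x = c})))"
    using inj H by (auto simp: bij_betw_def blow_up_def)
  fix x y assume xy: "x \<in> verts G" "y \<in> verts G"
  show "{x, y} \<in> edges G \<longleftrightarrow>
    {h x, h y} \<in> edges (blow_up H (\<lambda>c. h ` {x \<in> verts G. cl x = c}))" (is "_ \<longleftrightarrow> ?b")
  proof
    assume "{x, y} \<in> edges G"
    then have "{cl x, cl y} \<in> edges H" using adj[OF xy] by simp
    moreover have "h x \<in> h ` {z \<in> verts G. cl z = cl x}" "h y \<in> h ` {z \<in> verts G. cl z = cl y}"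
      using xy by auto
    ultimately show ?b unfolding blow_up_def graph.simps mem_Collect_eq by blast
  next
    assume ?b
    then obtain a b where ab: "{h x, h y} = {h a, h b}" "a \<in> verts G" "b \<in> verts G"
      "{cl a, cl b} \<in> edges H" unfolding blow_up_def by auto
    then have "{x, y} = {a, b}" using inj xy by (auto simp: doubleton_eq_iff inj_on_eq_iff)
    then show "{x, y} \<in> edges G" using adj ab by simp
  qed
qed

text \<open>This is the part of the equality case that does not refer to vertex degrees. It is kept separate because
  the same graph is split a second time, along another pentagon, when the first choice turns out to be
  the wrong one.\<close>

locale pentagon_split = triangle_free_graph G for G :: "'a graph" +
  fixes u :: "5 \<Rightarrow> 'a" and A R :: "'a set"
  assumes verts_eq: "verts G = range u \<union> A \<union> R"
    and disj: "range u \<inter> A = {}" "range u \<inter> R = {}" "A \<inter> R = {}"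
    and cycle: "adj (u i) (u (i + 1))"
    and A_indep: "a \<in> A \<Longrightarrow> b \<in> A \<Longrightarrow> \<not> adj a b"
    and R_indep: "x \<in> R \<Longrightarrow> y \<in> R \<Longrightarrow> \<not> adj x y"
    and attach: "a \<in> A \<Longrightarrow> card (nbhd a \<inter> range u) = 2"
    and not_3col: "\<nexists>c. proper_colouring G 3 c"
begin

lemma finite_A [simp]: "finite A" and finite_R [simp]: "finite R"
  using finite_verts verts_eq by auto

lemma cycle_iff: "adj (u i) (u j) \<longleftrightarrow> j = i + 1 \<or> i = j + 1"
proof -
  have step: "adj (u i) (u j)" if "j = i + 1" for i j using cycle that by simp
  have skip: "\<not> adj (u i) (u j)" if "j = i + 2" for i j
    using no_triangle[OF cycle[of i] cycle[of "i + 1"]] that by (simp add: add.assoc)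
  define d where "d = j - i"
  have "d = 0 \<or> d = 1 \<or> d = 2 \<or> d = 3 \<or> d = 4"
    by (rule exhaust_5)
  moreover have j: "j = i + d" by (simp add: d_def)
  moreover have "i = j + 2" if "d = 3" using that j by (simp add: add.assoc)
  moreover have "i = j + 1" if "d = 4" using that j by (simp add: add.assoc)
  ultimately show ?thesis using step[of i j] step[of j i] skip[of i j] skip[of j i]
    by (auto simp: adj_sym add.assoc)
qed

lemma inj_u: "inj u"
proof (rule injI)
  fix i j assume eq: "u i = u j"
  have "k = j + 1 \<or> j = k + 1" if "k = i + 1 \<or> i = k + 1" for k
    using that eq cycle_iff[of i k] cycle_iff[of j k] by simp
  from this[of "i + 1"] this[of "i - 1"] show "i = j"
    by (auto simp: algebra_simps)
qed

text \<open>In a blow-up of the Groetzsch graph, \<open>cls i\<close> is the set that replaces the vertex \<open>V i\<close>.\<close>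

definition cls :: "5 \<Rightarrow> 'a set" where
  "cls i = {a \<in> A. adj a (u (i - 1)) \<and> adj a (u (i + 1))}"

lemma cls_D: "a \<in> cls i \<Longrightarrow> a \<in> A \<and> adj a (u (i - 1)) \<and> adj a (u (i + 1))"
  by (simp add: cls_def)

lemma cls_adj: 
  assumes "a \<in> cls i"
  shows "adj a (u j) \<longleftrightarrow> j = i - 1 \<or> j = i + 1"
proof -
  have "card {u (i - 1), u (i + 1)} = 2" using inj_u by (auto simp: card_insert_if inj_eq)
  moreover have "{u (i - 1), u (i + 1)} \<subseteq> nbhd a \<inter> range u" using assms by (auto simp: cls_def)
  ultimately have "nbhd a \<inter> range u = {u (i - 1), u (i + 1)}"
    using attach[of a] assms by (metis card_subset_eq cls_D finite_Int finite_nbhd)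
  then have "u j \<in> nbhd a \<longleftrightarrow> u j \<in> {u (i - 1), u (i + 1)}" by blast
  then show ?thesis using inj_u by (simp add: inj_eq)
qed

lemma cls_cover:
  assumes "a \<in> A"
  obtains i where "a \<in> cls i"
proof -
  obtain p q where pq: "nbhd a \<inter> range u = {p, q}" "p \<noteq> q"
    using attach[OF assms] by (auto simp: card_2_iff)
  then obtain i j where ij: "p = u i" "q = u j" by (metis IntD2 insertI1 insertI2 rangeE)
  have adj: "adj a (u i)" "adj a (u j)" "i \<noteq> j" using pq ij by auto
  have "\<not> adj (u i) (u j)" using no_triangle[OF adj(1)] adj(2) by blast
  then have ne: "j \<noteq> i + 1" "i \<noteq> j + 1" by (auto simp: cycle_iff)
  define d where "d = j - i"
  have j: "j = i + d" by (simp add: d_def)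
  have "d = 0 \<or> d = 1 \<or> d = 2 \<or> d = 3 \<or> d = 4"
    by (rule exhaust_5)
  then have "j = i + 2 \<or> i = j + 2" using adj(3) ne j by (auto simp: add.assoc)
  then have "a \<in> cls (i + 1) \<or> a \<in> cls (j + 1)"
    using adj assms by (auto simp: cls_def add.assoc)
  then show thesis using that by blast
qed

lemma cls_disjoint: "i \<noteq> j \<Longrightarrow> cls i \<inter> cls j = {}"
proof (rule ccontr)
  assume ij: "i \<noteq> j" "cls i \<inter> cls j \<noteq> {}"
  then obtain a where a: "a \<in> cls i" "a \<in> cls j" by blast
  have *: "k = i - 1 \<or> k = i + 1 \<longleftrightarrow> k = j - 1 \<or> k = j + 1" for k
    using cls_adj[OF a(1)] cls_adj[OF a(2)] by blast
  show False using *[of "i + 1"] *[of "i - 1"] ij by (auto simp: algebra_simps)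
qed

text \<open>Otherwise a 3-colouring exists: \<open>u k\<close> and all of \<open>R\<close> get colour 2, the path
  \<open>u (k + 1), \<dots>, u (k + 4)\<close> alternates between 0 and 1, and \<open>A\<close> is coloured with 0 and 1. The only class
  that sees both 0 and 1 on the pentagon is \<open>cls k\<close>, which is empty.\<close>

lemma empty_cls_attach:
  assumes "cls k = {}"
  shows "\<exists>x\<in>R. adj x (u k)"
proof (rule ccontr)
  assume "\<not> ?thesis"
  then have no: "\<not> adj x (u k)" if "x \<in> R" for x using that by blast
  define c :: "'a \<Rightarrow> nat" where
    "c y = (if y \<in> R \<or> y = u k then 2
      else if y \<in> A then of_bool (adj y (u (k + 1)) \<or> adj y (u (k + 3)))
      else if y = u (k + 1) \<or> y = u (k + 3) then 0 else 1)" for y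
  have notin: "u i \<notin> A" "u i \<notin> R" for i using disj by auto
  have c_u: "c (u (k + d)) = (if d = 0 then 2 else if d = 1 \<or> d = 3 then 0 else 1)" for d
    using notin inj_u by (auto simp: c_def inj_eq)
  have c_R: "c x = 2" if "x \<in> R" for x using that by (simp add: c_def)
  have c_A: "c a = of_bool (adj a (u (k + 1)) \<or> adj a (u (k + 3)))" if "a \<in> A" for a
    using that notin disj by (auto simp: c_def)
  have uu: "c (u i) \<noteq> c (u (i + 1))" for i
  proof -
    have "\<forall>d. c (u (k + d)) \<noteq> c (u (k + (d + 1)))" unfolding c_u by (simp add: forall_5)
    from this[rule_format, of "i - k"] show ?thesis by (simp add: algebra_simps)
  qed
  have Au: "c a \<noteq> c (u j)" if "a \<in> A" "adj a (u j)" for a j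
  proof -
    obtain i where i: "a \<in> cls i" using cls_cover[OF \<open>a \<in> A\<close>] .
    define d where "d = i - k"
    define e where "e = j - k"
    have ij: "i = k + d" "j = k + e" by (simp_all add: d_def e_def)
    have "d \<noteq> 0" using i assms ij by auto
    have adj_a: "adj a (u (k + m)) \<longleftrightarrow> m = d - 1 \<or> m = d + 1" for m
      using cls_adj[OF i, of "k + m"] by (auto simp: ij algebra_simps)
    have "\<forall>d :: 5. d \<noteq> 0 \<longrightarrow> (\<forall>e. e = d - 1 \<or> e = d + 1 \<longrightarrow>
      of_bool ((1 = d - 1 \<or> 1 = d + 1) \<or> 3 = d - 1 \<or> 3 = d + 1)
        \<noteq> (if e = 0 then 2 else if e = 1 \<or> e = 3 then 0 else 1 :: nat))"
      by (simp add: forall_5)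
    then show ?thesis
      using \<open>d \<noteq> 0\<close> that adj_a unfolding c_A[OF that(1)] ij(2) c_u adj_a by blast
  qed
  have AR: "c a \<noteq> c x" if "a \<in> A" "x \<in> R" for a x
    using that by (simp add: c_A c_R)
  have uR: "c (u j) \<noteq> c x" if "x \<in> R" "adj x (u j)" for j x
  proof -
    have "j \<noteq> k" using no that by auto
    then show ?thesis using c_u[of "j - k"] c_R that by (auto split: if_splits)
  qed
  have "proper_colouring G 3 c"
    unfolding proper_colouring_def
  proof (intro conjI ballI impI)
    show "c ` verts G \<subseteq> {..<3}" by (auto simp: c_def)
    fix x y assume "x \<in> verts G" "y \<in> verts G" and xy: "adj x y"
    then have "x \<in> range u \<union> A \<union> R" "y \<in> range u \<union> A \<union> R" using verts_eq by simp_all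
    moreover have "\<not> (x \<in> A \<and> y \<in> A)" "\<not> (x \<in> R \<and> y \<in> R)" using A_indep R_indep xy by auto
    ultimately consider "x \<in> range u" "y \<in> range u" | "x \<in> A" "y \<in> range u" | "x \<in> range u" "y \<in> A"
      | "x \<in> R" "y \<in> range u" | "x \<in> range u" "y \<in> R" | "x \<in> A" "y \<in> R" | "x \<in> R" "y \<in> A"
      by blast
    then show "c x \<noteq> c y"
    proof cases
      case 1
      then obtain i j where ij: "x = u i" "y = u j" by auto
      then have "j = i + 1 \<or> i = j + 1" using xy cycle_iff by simp
      then show ?thesis using uu[of i] uu[of j] ij by auto
    next
      case 2
      then show ?thesis using Au xy by auto
    next
      case 3
      then obtain j where "x = u j" by auto
      then show ?thesis using Au[of y j] xy 3 adj_sym by auto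
    next
      case 4
      then obtain j where "y = u j" by auto
      then show ?thesis using uR[of x j] xy 4 by auto
    next
      case 5
      then obtain j where "x = u j" by auto
      then show ?thesis using uR[of y j] xy 5 adj_sym by auto
    next
      case 6
      then show ?thesis using AR by auto
    next
      case 7
      then show ?thesis using AR[of y x] by auto
    qed
  qed
  then show False using not_3col by blast
qed

end

section \<open>Recognising members of the family\<close>

lemma floor_half: "\<lfloor>real_of_int k / 2\<rfloor> = k div 2"
  using floor_divide_of_int_eq[of k 2] by simp

lemma ceiling_half: "\<lceil>real_of_int k / 2\<rceil> = (k + 1) div 2"
proof -
  have "\<lceil>real_of_int k / 2\<rceil> = - ((- k) div 2)"
    using ceiling_divide_eq_div[of k 2] by simp
  also have "\<dots> = (k + 1) div 2" by presburger
  finally show ?thesis .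
qed

text \<open>The two size conditions of the family say that the sizes \<open>a\<close> and \<open>r + 2\<close>, whose sum is
  \<open>n - 3\<close>, are as equal as possible.\<close>

lemma half_sizes_iff:
  assumes "n = 5 + a + r"
  shows "(int a = \<lfloor>(real n - 3) / 2\<rfloor> \<and> int r = \<lceil>(real n - 7) / 2\<rceil> \<or>
      int a = \<lceil>(real n - 3) / 2\<rceil> \<and> int r = \<lfloor>(real n - 7) / 2\<rfloor>)
    \<longleftrightarrow> \<bar>int a - int (r + 2)\<bar> \<le> 1"
proof -
  have half: "m = k div 2 \<longleftrightarrow> 2 * m \<le> k \<and> k < 2 * m + 2" for k m :: int by auto
  have "real n - 3 = real_of_int (int a + int r + 2)" "real n - 7 = real_of_int (int a + int r - 2)"
    using assms by simp_all
  then show ?thesis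
    unfolding floor_half ceiling_half by (simp only: floor_half ceiling_half half) arith
qed

context pentagon_split
begin

text \<open>The indices of the neighbours of \<open>y\<close> are disjoint from their own shift by 1, since the graph has no
  triangle.\<close>

lemma card_nbhd_pentagon: "card (nbhd y \<inter> range u) \<le> 2"
proof -
  define I where "I = {i. adj y (u i)}"
  have "nbhd y \<inter> range u = u ` I" by (auto simp: I_def)
  then have "card (nbhd y \<inter> range u) = card I"
    using inj_u by (simp add: card_image inj_on_subset)
  moreover have "I \<inter> (\<lambda>i. i + 1) ` I = {}"
    using no_triangle[of y "u i" "u (i + 1)" for i] cycle by (auto simp: I_def)
  then have "card (I \<union> (\<lambda>i. i + 1) ` I) = 2 * card I"
    by (subst card_Un_disjoint) (auto simp: card_image)
  moreover have "card (I \<union> (\<lambda>i. i + 1) ` I) \<le> card (UNIV :: 5 set)"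
    by (rule card_mono) auto
  ultimately show ?thesis by simp
qed

lemma A_eq_UN_cls: "A = (\<Union>i. cls i)"
proof
  show "A \<subseteq> (\<Union>i. cls i)" using cls_cover by (metis UN_I UNIV_I subsetI)
  show "(\<Union>i. cls i) \<subseteq> A" using cls_D by (metis UN_E subsetI)
qed

lemma card_A: "card A = (\<Sum>i\<in>UNIV. card (cls i))"
proof -
  have "finite (cls i)" for i by (rule finite_subset[OF _ finite_A]) (auto dest: cls_D)
  then have "card (\<Union>i. cls i) = (\<Sum>i\<in>UNIV. card (cls i))"
    using cls_disjoint by (intro card_UN_disjoint) auto
  then show ?thesis using A_eq_UN_cls by metis
qed

lemma card_verts: "card (verts G) = 5 + card A + card R"
proof -
  have "card (range u) = 5" using inj_u by (simp add: card_image)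
  then show ?thesis unfolding verts_eq using disj
    by (subst card_Un_disjoint; (subst card_Un_disjoint)?) auto
qed

text \<open>As \<open>R\<close> sees nothing of the pentagon, no class is empty by \<open>empty_cls_attach\<close>, and every adjacency is
  determined by the classes, with \<open>R\<close> replacing \<open>W\<close>.\<close>

lemma graph_iso_grotzsch_family:
  assumes complete: "\<And>a x. a \<in> A \<Longrightarrow> x \<in> R \<Longrightarrow> adj a x"
    and separate: "\<And>x i. x \<in> R \<Longrightarrow> \<not> adj x (u i)"
    and balanced: "\<bar>int (card A) - int (card R + 2)\<bar> \<le> 1"
  shows "\<exists>H \<in> (grotzsch_family (card (verts G)) :: nat graph set). graph_iso G H"
proof -
  have ne: "cls i \<noteq> {}" for i using empty_cls_attach[of i] separate by blast
  have fin_cls: "finite (cls i)" for i by (rule finite_subset[OF _ finite_A]) (auto dest: cls_D)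
  \<comment> \<open>Five nonempty classes give \<open>card A \<ge> 5\<close>, and then \<open>balanced\<close> keeps \<open>R\<close> nonempty.\<close>
  have "(\<Sum>i\<in>(UNIV :: 5 set). 1) \<le> (\<Sum>i\<in>UNIV. card (cls i))"
    using ne fin_cls by (intro sum_mono) (simp add: Suc_le_eq card_gt_0_iff)
  then have "5 \<le> card A" by (simp add: card_A)
  then have "card R \<noteq> 0" using balanced by linarith
  then have R_ne: "R \<noteq> {}" by auto
  define cl where "cl x = (if x \<in> R then W else if x \<in> A then V (THE i. x \<in> cls i)
    else U (inv u x))" for x
  have cl_R: "cl x = W" if "x \<in> R" for x using that by (simp add: cl_def)
  have cl_u: "cl (u i) = U i" for i
  proof -
    have "u i \<notin> A" "u i \<notin> R" using disj by auto
    then show ?thesis using inj_u by (simp add: cl_def)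
  qed
  have cl_A: "cl a = V i" if "a \<in> cls i" for a i
  proof -
    have "(THE i. a \<in> cls i) = i" using that cls_disjoint by (intro the_equality) blast+
    moreover have "a \<in> A" "a \<notin> R" using that cls_D disj by blast+
    ultimately show ?thesis by (simp add: cl_def)
  qed
  have cases: thesis if "x \<in> verts G" "\<And>i. x = u i \<Longrightarrow> thesis" "\<And>i. x \<in> cls i \<Longrightarrow> thesis"
    "x \<in> R \<Longrightarrow> thesis" for x thesis
    using that verts_eq cls_cover[of x] by blast
  have adj: "adj x y \<longleftrightarrow> {cl x, cl y} \<in> edges grotzsch_graph"
    if "x \<in> verts G" "y \<in> verts G" for x y
    using that(1)
  proof (rule cases)
    fix i assume x: "x = u i"
    show ?thesis using that(2)
    proof (rule cases)
      fix j assume "y = u j"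
      then show ?thesis using x by (simp add: cl_u cycle_iff)
    next
      fix j assume "y \<in> cls j"
      then show ?thesis using x cls_adj[of y j i] by (auto simp: cl_u cl_A adj_sym)
    next
      assume "y \<in> R"
      then show ?thesis using x separate[of y i] by (simp add: cl_u cl_R adj_sym)
    qed
  next
    fix i assume x: "x \<in> cls i"
    show ?thesis using that(2)
    proof (rule cases)
      fix j assume "y = u j"
      then show ?thesis using x cls_adj[of x i j] by (auto simp: cl_u cl_A)
    next
      fix j assume "y \<in> cls j"
      then show ?thesis using x A_indep[of x y] by (simp add: cl_A cls_D)
    next
      assume "y \<in> R"
      then show ?thesis using x complete[of x y] by (simp add: cl_A cl_R cls_D)
    qed
  next
    assume x: "x \<in> R"
    show ?thesis using that(2)
    proof (rule cases)
      fix j assume "y = u j"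
      then show ?thesis using x separate[of x j] by (simp add: cl_u cl_R)
    next
      fix j assume "y \<in> cls j"
      then show ?thesis using x complete[of y x] by (simp add: cl_A cl_R cls_D adj_sym)
    next
      assume "y \<in> R"
      then show ?thesis using x R_indep[of x y] by (simp add: cl_R)
    qed
  qed
  obtain h :: "'a \<Rightarrow> nat" where h: "inj_on h (verts G)"
    using finite_imp_inj_to_nat_seg[OF finite_verts] by blast
  define P where "P c = {x \<in> verts G. cl x = c}" for c
  define B where "B c = h ` P c" for c
  define H where "H = blow_up grotzsch_graph B"
  have "graph_iso G H" unfolding H_def B_def P_def
    using h adj by (intro graph_iso_blow_up_classes) (auto simp: grotzsch_graph_def)
  moreover have "H \<in> grotzsch_family (card (verts G))"
  proof -
    have notin: "u i \<notin> R" "u i \<notin> cls j" "x \<in> cls j \<Longrightarrow> x \<notin> R" for i j x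
      using disj cls_D by blast+
    have unique: "x \<in> cls i \<Longrightarrow> x \<in> cls j \<longleftrightarrow> i = j" for x i j
      using cls_disjoint by blast
    have cl_iff: "(cl x = U i \<longleftrightarrow> x = u i) \<and> (cl x = V i \<longleftrightarrow> x \<in> cls i) \<and> (cl x = W \<longleftrightarrow> x \<in> R)"
      if "x \<in> verts G" for x i
      using that
    proof (rule cases)
      fix j assume "x = u j"
      then show ?thesis using notin inj_u by (simp add: cl_u inj_eq)
    next
      fix j assume "x \<in> cls j"
      then show ?thesis using notin unique by (auto simp: cl_A)
    next
      assume "x \<in> R"
      then show ?thesis using notin by (auto simp: cl_R)
    qed
    have P: "P (U i) = {u i}" "P (V i) = cls i" "P W = R" for i
      using cl_iff verts_eq cls_D unfolding P_def by blast+
    have card_B: "card (B c) = card (P c)" for c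
      unfolding B_def by (rule card_image) (rule inj_on_subset[OF h], auto simp: P_def)
    have "disjoint_family B"
      unfolding disjoint_family_on_def B_def P_def using h by (auto simp: inj_on_eq_iff)
    moreover have "finite (B c)" for c by (simp add: B_def P_def)
    moreover have "B c \<noteq> {}" for c by (cases c) (simp_all add: B_def P ne R_ne)
    moreover have "card (B (U i)) = 1" for i by (simp add: card_B P)
    moreover have "verts H = h ` verts G" by (auto simp: H_def blow_up_def grotzsch_graph_def B_def P_def)
    then have "card (verts H) = card (verts G)" using h by (simp add: card_image)
    moreover have "(\<Sum>i\<in>UNIV. card (B (V i))) = card A" by (simp add: card_B P card_A)
    moreover have "card (B W) = card R" by (simp add: card_B P)
    moreover have "int (card A) = \<lfloor>(real (card (verts G)) - 3) / 2\<rfloor> \<and>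
        int (card R) = \<lceil>(real (card (verts G)) - 7) / 2\<rceil> \<or>
      int (card A) = \<lceil>(real (card (verts G)) - 3) / 2\<rceil> \<and>
        int (card R) = \<lfloor>(real (card (verts G)) - 7) / 2\<rfloor>"
      using half_sizes_iff[OF card_verts] balanced by simp
    ultimately show ?thesis unfolding grotzsch_family_def H_def
      by (intro CollectI exI[of _ B]) (simp del: of_nat_sum)
  qed
  ultimately show ?thesis by blast
qed

end

section \<open>Choosing the right pentagon\<close>

lemma (in pentagon_split) pentagon_split_reindex:
  assumes "range u' = range u" "\<And>i. adj (u' i) (u' (i + 1))"
  shows "pentagon_split G u' A R"
proof
  show "verts G = range u' \<union> A \<union> R" "range u' \<inter> A = {}" "range u' \<inter> R = {}" "A \<inter> R = {}"
    using assms(1) verts_eq disj by simp_all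
  show "adj (u' i) (u' (i + 1))" for i by (rule assms(2))
  show "\<not> adj a b" if "a \<in> A" "b \<in> A" for a b using that by (rule A_indep)
  show "\<not> adj x y" if "x \<in> R" "y \<in> R" for x y using that by (rule R_indep)
  show "card (nbhd a \<inter> range u') = 2" if "a \<in> A" for a
    unfolding assms(1) using that by (rule attach)
  show "\<nexists>c. proper_colouring G 3 c" by (rule not_3col)
qed

text \<open>The pentagon is indexed so that a class with at least three vertices has index 0. Three is one more
  than the number of neighbours that a vertex can have on the pentagon.\<close>

locale saturated_pentagon_split = pentagon_split +
  assumes deg_R: "x \<in> R \<Longrightarrow> card (nbhd x) = card A"
    and balanced: "\<bar>int (card A) - int (card R + 2)\<bar> \<le> 1"
    and large: "card (cls 0) \<ge> 3"
begin

text \<open>A vertex \<open>x\<close> of \<open>R\<close> has \<open>card A\<close> neighbours, all of them in \<open>A\<close> or on the pentagon, so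
  every neighbour on the pentagon is paid for by a missing neighbour in \<open>A\<close>.\<close>

lemma card_missing:
  assumes "x \<in> R"
  shows "card (A - nbhd x) = card (nbhd x \<inter> range u)"
proof -
  have "nbhd x \<subseteq> A \<union> range u"
    using R_indep[OF assms] nbhd_subset verts_eq by fastforce
  then have "nbhd x = (A \<inter> nbhd x) \<union> (nbhd x \<inter> range u)" by blast
  moreover have "(A \<inter> nbhd x) \<inter> (nbhd x \<inter> range u) = {}" using disj by blast
  ultimately have "card (nbhd x) = card (A \<inter> nbhd x) + card (nbhd x \<inter> range u)"
    by (metis card_Un_disjoint finite_Int finite_nbhd)
  moreover have "card A = card (A \<inter> nbhd x) + card (A - nbhd x)"
    by (metis card_Int_Diff finite_A)
  ultimately show ?thesis using deg_R[OF assms] by simp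
qed

lemma cls_missing:
  assumes "adj x (u j)" "j = i - 1 \<or> j = i + 1"
  shows "cls i \<subseteq> A - nbhd x"
proof
  fix a assume a: "a \<in> cls i"
  then have "adj a (u j)" using assms(2) by (simp add: cls_adj)
  then have "\<not> adj x a" using no_triangle[OF assms(1), of a] adj_sym by auto
  then show "a \<in> A - nbhd x" using a cls_D by auto
qed

text \<open>A neighbour \<open>u 1\<close> or \<open>u 4\<close> would make \<open>x\<close> miss the whole large class, more than the two vertices
  of \<open>A\<close> that \<open>x\<close> can miss.\<close>

lemma not_adj_1_4:
  assumes "x \<in> R"
  shows "\<not> adj x (u 1)" "\<not> adj x (u 4)"
proof -
  have "\<not> adj x (u j)" if "j = 0 - 1 \<or> j = 0 + 1" for j
  proof
    assume "adj x (u j)"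
    then have "card (cls 0) \<le> card (A - nbhd x)"
      using cls_missing[OF _ that] by (simp add: card_mono)
    then show False using card_missing[OF assms] card_nbhd_pentagon[of x] large by simp
  qed
  from this[of 1] this[of 4] show "\<not> adj x (u 1)" "\<not> adj x (u 4)" by simp_all
qed

lemma cls_1_4_nonempty: "cls 1 \<noteq> {}" "cls 4 \<noteq> {}"
  using empty_cls_attach not_adj_1_4 by blast+

lemma nbhd_pentagon:
  assumes "x \<in> R"
  shows "nbhd x \<inter> range u = (if adj x (u 0) then {u 0} else {}) \<union>
    (if adj x (u 2) then {u 2} else {}) \<union> (if adj x (u 3) then {u 3} else {})"
proof -
  have "range u = {u 0, u 1, u 2, u 3, u 4}" by (simp only: UNIV_5) simp
  then show ?thesis using not_adj_1_4[OF assms] by auto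
qed

lemma not_adj_2_and_3: "adj x (u 2) \<Longrightarrow> \<not> adj x (u 3)"
  using no_triangle[of x "u 2" "u 3"] cycle[of 2] by simp

text \<open>The vertex \<open>x\<close> misses the classes 1 and 3 because of \<open>u 2\<close>, and also class 4 if \<open>u 0\<close> is a neighbour
  too. By \<open>card_missing\<close> it misses one vertex of \<open>A\<close> if \<open>u 0\<close> is not a neighbour and two if it is,
  and \<open>p\<close>, respectively \<open>p\<close> and \<open>q\<close>, already account for these.\<close>

lemma adj_2_structure:
  assumes x: "x \<in> R" "adj x (u 2)" and pq: "p \<in> cls 1" "q \<in> cls 4"
  shows "cls 3 = {}" "cls 1 = {p}" "A - nbhd x = (if adj x (u 0) then {p, q} else {p})"
proof -
  have ne: "u 0 \<noteq> u 2" "p \<noteq> q" using inj_u pq cls_disjoint[of 1 4] by (auto simp: inj_eq)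
  have card: "card (A - nbhd x) = (if adj x (u 0) then 2 else 1)"
    using card_missing[OF x(1)] nbhd_pentagon[OF x(1)] not_adj_2_and_3[OF x(2)] x(2) ne
    by simp
  have fin: "finite (A - nbhd x)" by simp
  have sub: "cls 1 \<subseteq> A - nbhd x" "cls 3 \<subseteq> A - nbhd x"
    using cls_missing[OF x(2), of 1] cls_missing[OF x(2), of 3] by simp_all
  have "cls 4 \<subseteq> A - nbhd x" if "adj x (u 0)" using cls_missing[OF that, of 4] by simp
  then have "q \<in> A - nbhd x" if "adj x (u 0)" using that pq(2) by blast
  moreover have "p \<in> A - nbhd x" using sub(1) pq(1) by blast
  ultimately have "(if adj x (u 0) then {p, q} else {p}) \<subseteq> A - nbhd x" by simp
  then show eq: "A - nbhd x = (if adj x (u 0) then {p, q} else {p})"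
    using card_subset_eq[OF fin, of "if adj x (u 0) then {p, q} else {p}"] card ne(2) by simp
  have "A - nbhd x \<subseteq> {p, q}" unfolding eq by simp
  moreover have "q \<notin> cls 1" "p \<notin> cls 3" "q \<notin> cls 3"
    using pq cls_disjoint[of 1 4] cls_disjoint[of 1 3] cls_disjoint[of 3 4] by auto
  ultimately show "cls 1 = {p}" "cls 3 = {}" using sub pq by auto
qed

text \<open>Reflecting the pentagon exchanges the indices 2 and 3 and the classes 1 and 4, so each statement about
  \<open>u 2\<close> has a mirror image about \<open>u 3\<close>.\<close>

lemma reflected: "saturated_pentagon_split G (\<lambda>i. u (- i)) A R"
proof -
  have range: "range (\<lambda>i. u (- i)) = range u"
    using image_image[of u uminus UNIV] surjI[of uminus "uminus :: 5 \<Rightarrow> 5"] by simp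
  interpret r: pentagon_split G "\<lambda>i. u (- i)" A R
    by (rule pentagon_split_reindex[OF range]) (simp add: cycle_iff)
  have "r.cls 0 = cls 0" unfolding r.cls_def cls_def by auto
  then show ?thesis by unfold_locales (use deg_R balanced large in simp_all)
qed

lemma adj_3_structure:
  assumes x: "x \<in> R" "adj x (u 3)" and pq: "p \<in> cls 1" "q \<in> cls 4"
  shows "cls 2 = {}" "cls 4 = {q}" "A - nbhd x = (if adj x (u 0) then {p, q} else {q})"
proof -
  interpret r: saturated_pentagon_split G "\<lambda>i. u (- i)" A R by (rule reflected)
  have cls: "r.cls 1 = cls 4" "r.cls 4 = cls 1" "r.cls 3 = cls 2"
    unfolding r.cls_def cls_def by auto
  show "cls 2 = {}" "cls 4 = {q}" "A - nbhd x = (if adj x (u 0) then {p, q} else {q})"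
    using r.adj_2_structure[of x q p] assms unfolding cls by (simp_all add: insert_commute)
qed

text \<open>If \<open>u 0\<close> were the only neighbour on the pentagon, then \<open>x\<close> would miss one vertex of \<open>A\<close>, but it
  misses the two nonempty classes 1 and 4.\<close>

lemma attached_adj_2_or_3:
  assumes "x \<in> R" "adj x (u i)"
  shows "adj x (u 2) \<or> adj x (u 3)"
proof (rule ccontr)
  assume no: "\<not> (adj x (u 2) \<or> adj x (u 3))"
  have "u i \<in> nbhd x \<inter> range u" using assms(2) by simp
  then have 0: "adj x (u 0)" using no nbhd_pentagon[OF assms(1)] by (auto split: if_splits)
  then have "card (A - nbhd x) = 1"
    using no nbhd_pentagon[OF assms(1)] card_missing[OF assms(1)] by simp
  moreover obtain p q where pq: "p \<in> cls 1" "q \<in> cls 4" using cls_1_4_nonempty by blast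
  then have "{p, q} \<subseteq> A - nbhd x"
    using cls_missing[OF 0, of 1] cls_missing[OF 0, of 4] by auto
  then have "card {p, q} \<le> card (A - nbhd x)" by (simp add: card_mono)
  moreover have "p \<noteq> q" using pq cls_disjoint[of 1 4] by auto
  ultimately show False by simp
qed

text \<open>A vertex of \<open>R\<close> adjacent to \<open>u 2\<close> makes class 3 empty, so some vertex of \<open>R\<close> is adjacent to
  \<open>u 3\<close>, which makes class 2 empty, and conversely. Hence \<open>A\<close> is \<open>cls 0\<close> together with \<open>p\<close> and \<open>q\<close>, and
  every vertex of \<open>R\<close> is complete to \<open>cls 0\<close>. On the pentagon \<open>u 0, p, u 2, u 3, q\<close> every vertex of
  \<open>R\<close> has exactly two neighbours, since it trades \<open>p\<close> or \<open>q\<close> for neighbours among \<open>u 0, u 2, u 3\<close>.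
  So the roles of \<open>A\<close> and \<open>R\<close> are exchanged, up to a transfer of two vertices.\<close>

lemma graph_iso_grotzsch_family_if_attached:
  assumes "z \<in> R" "adj z (u i)"
  shows "\<exists>H \<in> (grotzsch_family (card (verts G)) :: nat graph set). graph_iso G H"
proof -
  obtain p q where pq: "p \<in> cls 1" "q \<in> cls 4" using cls_1_4_nonempty by blast
  note s2 = adj_2_structure[OF _ _ pq] and s3 = adj_3_structure[OF _ _ pq]
  have "\<exists>y\<in>R. adj y (u 3)" if "x \<in> R" "adj x (u 2)" for x
    by (rule empty_cls_attach[OF s2(1)[OF that]])
  moreover have "\<exists>y\<in>R. adj y (u 2)" if "x \<in> R" "adj x (u 3)" for x
    by (rule empty_cls_attach[OF s3(1)[OF that]])
  ultimately obtain x y where "x \<in> R" "adj x (u 2)" "y \<in> R" "adj y (u 3)"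
    using attached_adj_2_or_3[OF assms] assms(1) by metis
  then have cls: "cls 2 = {}" "cls 3 = {}" "cls 1 = {p}" "cls 4 = {q}"
    by (simp_all only: s2(1,2)[of x] s3(1,2)[of y])
  have "A = (\<Union>i\<in>{0, 1, 2, 3, 4}. cls i)" using A_eq_UN_cls UNIV_5 by simp
  also have "\<dots> = cls 0 \<union> {p, q}" by (auto simp: cls)
  finally have A: "A = cls 0 \<union> {p, q}" .
  then have A_iff: "x \<in> A \<longleftrightarrow> x \<in> cls 0 \<or> x = p \<or> x = q" for x by blast
  have pA: "p \<in> A" "q \<in> A" "p \<noteq> q" "p \<notin> cls 0" "q \<notin> cls 0"
    using A_iff pq cls_disjoint[of 1 4] cls_disjoint[of 0 1] cls_disjoint[of 0 4] by auto
  have p: "adj p (u j) \<longleftrightarrow> j = 0 \<or> j = 2" and q: "adj q (u j) \<longleftrightarrow> j = 3 \<or> j = 0" for j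
    using cls_adj[OF pq(1)] cls_adj[OF pq(2)] by simp_all
  have missing: "A - nbhd x = (if adj x (u 2) then if adj x (u 0) then {p, q} else {p}
      else if adj x (u 3) then if adj x (u 0) then {p, q} else {q} else {})"
    if "x \<in> R" for x
  proof (cases "adj x (u 2) \<or> adj x (u 3)")
    case True
    then show ?thesis using s2(3)[OF that] s3(3)[OF that] by auto
  next
    case False
    then have "nbhd x \<inter> range u = {}" using attached_adj_2_or_3[OF that] by auto
    then have "A - nbhd x = {}" using card_missing[OF that] by simp
    then show ?thesis using False by simp
  qed
  define u' :: "5 \<Rightarrow> 'a" where
    "u' i = (if i = 0 then u 0 else if i = 1 then p else if i = 2 then u 2
      else if i = 3 then u 3 else q)" for i
  have u': "u' 0 = u 0" "u' 1 = p" "u' 2 = u 2" "u' 3 = u 3" "u' 4 = q"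
    by (simp_all add: u'_def)
  have range_u': "range u' = {u 0, p, u 2, u 3, q}" by (simp only: UNIV_5) (simp add: u')
  have range_u: "range u = {u 0, u 1, u 2, u 3, u 4}" by (simp only: UNIV_5) simp
  have u_ne: "u i \<notin> A" "u i \<notin> R" "u i = u j \<longleftrightarrow> i = j" for i j
    using disj inj_u by (auto simp: inj_eq)
  have ne: "u i \<noteq> p" "u i \<noteq> q" "u i \<notin> cls 0" "x \<in> R \<Longrightarrow> x \<notin> cls 0" for i x
    using u_ne pA cls_D disj by blast+
  interpret s: pentagon_split G u' "R \<union> {u 1, u 4}" "cls 0"
  proof
    show "verts G = range u' \<union> (R \<union> {u 1, u 4}) \<union> cls 0"
      unfolding verts_eq range_u' range_u by (auto simp: A_iff)
    show "range u' \<inter> (R \<union> {u 1, u 4}) = {}"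
      unfolding range_u' using u_ne ne pA disj by auto
    show "range u' \<inter> cls 0 = {}" "(R \<union> {u 1, u 4}) \<inter> cls 0 = {}"
      unfolding range_u' using ne pA by auto
    have "\<forall>i. adj (u' i) (u' (i + 1))"
      by (subst forall_5) (simp add: u' cycle_iff p q adj_sym)
    then show "adj (u' i) (u' (i + 1))" for i by blast
    show "\<not> adj a b" if "a \<in> R \<union> {u 1, u 4}" "b \<in> R \<union> {u 1, u 4}" for a b
      using that R_indep not_adj_1_4 cycle_iff by (auto simp: adj_sym)
    show "\<not> adj a b" if "a \<in> cls 0" "b \<in> cls 0" for a b
      using that A_indep cls_D by blast
    show "card (nbhd a \<inter> range u') = 2" if "a \<in> R \<union> {u 1, u 4}" for a
    proof -
      consider "a \<in> R" | "a = u 1" | "a = u 4" using \<open>a \<in> _\<close> by auto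
      then show ?thesis
      proof cases
        case 1
        have "adj a p \<longleftrightarrow> p \<notin> A - nbhd a" "adj a q \<longleftrightarrow> q \<notin> A - nbhd a" using pA by auto
        \<comment> \<open>Of the neighbours \<open>u 2\<close> and \<open>u 0\<close>, each one alone already costs \<open>p\<close>; likewise for
          \<open>u 3\<close>, \<open>u 0\<close> and \<open>q\<close>.\<close>
        then have pq_iff: "adj a p \<longleftrightarrow> \<not> adj a (u 2) \<and> \<not> adj a (u 0)"
          "adj a q \<longleftrightarrow> \<not> adj a (u 3) \<and> \<not> adj a (u 0)"
          using missing[OF 1] pA(3) not_adj_2_and_3[of a] attached_adj_2_or_3[OF 1, of 0] by auto
        have split: "nbhd a \<inter> insert y S = (if adj a y then insert y (nbhd a \<inter> S) else nbhd a \<inter> S)"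
          for y S by auto
        show ?thesis unfolding range_u'
          using pq_iff not_adj_2_and_3[of a] attached_adj_2_or_3[OF 1, of 0] ne u_ne pA(3)
          by (cases "adj a (u 0)"; cases "adj a (u 2)"; cases "adj a (u 3)")
            (auto simp: split card_insert_if)
      next
        case 2
        then have "nbhd a \<inter> range u' = {u 0, u 2}"
          unfolding range_u' using cycle_iff p q adj_sym by auto
        then show ?thesis using u_ne by (simp add: card_insert_if)
      next
        case 3
        then have "nbhd a \<inter> range u' = {u 0, u 3}"
          unfolding range_u' using cycle_iff p q adj_sym by auto
        then show ?thesis using u_ne by (simp add: card_insert_if)
      qed
    qed
    show "\<nexists>c. proper_colouring G 3 c" by (rule not_3col)
  qed
  show ?thesis
  proof (rule s.graph_iso_grotzsch_family)
    show "adj a x" if "a \<in> R \<union> {u 1, u 4}" "x \<in> cls 0" for a x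
    proof (cases "a \<in> R")
      case True
      have "x \<notin> A - nbhd a" using missing[OF True] that pA by (auto split: if_splits)
      then show ?thesis using that cls_D by auto
    next
      case False
      then show ?thesis using that cls_adj[of x 0] adj_sym by auto
    qed
    show "\<not> adj x (u' i)" if "x \<in> cls 0" for x i
    proof -
      have "u' i \<in> {u 0, p, u 2, u 3, q}" using range_u' by auto
      then show ?thesis using that cls_adj[OF that] A_indep[of x] pA cls_D by auto
    qed
    have "finite (cls 0)" using finite_A A by (metis finite_Un)
    then have "card (cls 0 \<union> {p, q}) = card (cls 0) + 2" using pA by simp
    then have "card A = card (cls 0) + 2" using A by metis
    moreover have "card (R \<union> {u 1, u 4}) = card R + 2" using u_ne by simp
    ultimately show "\<bar>int (card (R \<union> {u 1, u 4})) - int (card (cls 0) + 2)\<bar> \<le> 1"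
      using balanced by simp
  qed
qed

lemma graph_iso_grotzsch_family_saturated:
  "\<exists>H \<in> (grotzsch_family (card (verts G)) :: nat graph set). graph_iso G H"
proof (cases "\<exists>x\<in>R. \<exists>i. adj x (u i)")
  case True
  then show ?thesis using graph_iso_grotzsch_family_if_attached by blast
next
  case False
  show ?thesis
  proof (rule graph_iso_grotzsch_family)
    show "\<not> adj x (u i)" if "x \<in> R" for x i using False that by blast
    show "adj a x" if "a \<in> A" "x \<in> R" for a x
    proof -
      have "nbhd x \<inter> range u = {}" using False that by auto
      then have "A - nbhd x = {}" using card_missing[OF that(2)] by simp
      then show ?thesis using that adj_sym by auto
    qed
  qed (rule balanced)
qed

end

context pentagon_split
begin

text \<open>The five classes partition \<open>A\<close>, so if \<open>card A > 10\<close> one of them has at least three vertices; rotating the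
  pentagon gives it index 0.\<close>

lemma graph_iso_grotzsch_family_extremal:
  assumes deg_R: "\<And>x. x \<in> R \<Longrightarrow> card (nbhd x) = card A"
    and balanced: "\<bar>int (card A) - int (card R + 2)\<bar> \<le> 1" and "card A > 10"
  shows "\<exists>H \<in> (grotzsch_family (card (verts G)) :: nat graph set). graph_iso G H"
proof -
  have "\<exists>k. card (cls k) \<ge> 3"
  proof (rule ccontr)
    assume "\<not> ?thesis"
    then have "card (cls k) < 3" for k using not_le by blast
    then have "card (cls k) \<le> 2" for k by (simp add: less_Suc_eq_le[symmetric])
    then have "(\<Sum>k\<in>UNIV. card (cls k)) \<le> (\<Sum>k\<in>(UNIV :: 5 set). 2)" by (rule sum_mono)
    then show False using card_A \<open>card A > 10\<close> by simp
  qed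
  then obtain k where k: "card (cls k) \<ge> 3" by blast
  have range: "range (\<lambda>i. u (i + k)) = range u"
    using image_image[of u "\<lambda>i. i + k" UNIV] surjI[of "\<lambda>i. i + k" "\<lambda>i. i - k"] by simp
  interpret r: pentagon_split G "\<lambda>i. u (i + k)" A R
    by (rule pentagon_split_reindex[OF range]) (simp add: cycle_iff add.commute add.left_commute)
  have k4: "k - 1 = k + 4" unfolding diff_eq_eq by (simp add: add.assoc)
  have "r.cls 0 = cls k" unfolding r.cls_def cls_def k4 by (simp add: add.commute)
  then interpret r: saturated_pentagon_split G "\<lambda>i. u (i + k)" A R
    by unfold_locales (use deg_R balanced k in simp_all)
  show ?thesis by (rule r.graph_iso_grotzsch_family_saturated)
qed

end

section \<open>Counting the edges of members of the family\<close>

text \<open>The relation \<open>Q\<close> orients the edges of \<open>H\<close>. Fixing an orientation turns every edge of the blow-up into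
  exactly one ordered pair.\<close>

lemma card_edges_blow_up:
  assumes disj: "disjoint_family B" and fin: "\<And>x. finite (B x)" "finite Q"
    and Q: "\<And>x y. {x, y} \<in> edges H \<longleftrightarrow> (x, y) \<in> Q \<or> (y, x) \<in> Q"
    and asym: "\<And>x y. (x, y) \<in> Q \<Longrightarrow> (y, x) \<notin> Q"
  shows "card (edges (blow_up H B)) = (\<Sum>(x, y)\<in>Q. card (B x) * card (B y))"
proof -
  define S where "S q = B (fst q) \<times> B (snd q)" for q
  have same: "x = y" if "a \<in> B x" "a \<in> B y" for a x y
    using disj that by (auto simp: disjoint_family_on_def)
  have "edges (blow_up H B) = (\<lambda>(a, b). {a, b}) ` (\<Union>q\<in>Q. S q)" (is "?E = ?I")
  proof
    show "?E \<subseteq> ?I"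
    proof
      fix e assume "e \<in> ?E"
      then obtain a b x y where e: "e = {a, b}" "{x, y} \<in> edges H" "a \<in> B x" "b \<in> B y"
        by (auto simp: blow_up_def)
      then consider "(a, b) \<in> S (x, y)" "(x, y) \<in> Q" | "(b, a) \<in> S (y, x)" "(y, x) \<in> Q"
        using Q by (auto simp: S_def)
      then show "e \<in> ?I"
      proof cases
        case 1
        then show ?thesis using e(1) by (intro image_eqI[of _ _ "(a, b)"]) auto
      next
        case 2
        then show ?thesis using e(1) by (intro image_eqI[of _ _ "(b, a)"]) auto
      qed
    qed
    show "?I \<subseteq> ?E"
    proof
      fix e assume "e \<in> ?I"
      then obtain a b x y where "e = {a, b}" "(x, y) \<in> Q" "a \<in> B x" "b \<in> B y"
        by (auto simp: S_def)
      then show "e \<in> ?E" unfolding blow_up_def graph.simps mem_Collect_eq using Q by blast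
    qed
  qed
  moreover have "inj_on (\<lambda>(a, b). {a, b}) (\<Union>q\<in>Q. S q)"
  proof (rule inj_onI, clarify)
    fix a b c d x y x' y'
    assume *: "(x, y) \<in> Q" "(x', y') \<in> Q" "(a, b) \<in> S (x, y)" "(c, d) \<in> S (x', y')"
      and eq: "{a, b} = {c, d}"
    show "a = c \<and> b = d"
    proof (rule ccontr)
      assume "\<not> (a = c \<and> b = d)"
      then have "a = d" "b = c" using eq by (auto simp: doubleton_eq_iff)
      then have "x = y'" "y = x'" using * same unfolding S_def by auto
      then show False using * asym by blast
    qed
  qed
  ultimately have "card (edges (blow_up H B)) = card (\<Union>q\<in>Q. S q)" by (simp add: card_image)
  also have "\<dots> = (\<Sum>q\<in>Q. card (S q))"
  proof (rule card_UN_disjoint)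
    show "\<forall>p\<in>Q. \<forall>q\<in>Q. p \<noteq> q \<longrightarrow> S p \<inter> S q = {}"
      unfolding S_def using same by (fastforce simp: prod_eq_iff)
  qed (use fin in \<open>auto simp: S_def\<close>)
  also have "\<dots> = (\<Sum>(x, y)\<in>Q. card (B x) * card (B y))"
    by (simp add: S_def card_cartesian_product case_prod_beta)
  finally show ?thesis .
qed

lemma card_edges_blow_up_grotzsch:
  assumes "disjoint_family B" "\<And>x. finite (B x)" "\<And>i. card (B (U i)) = 1"
  shows "card (edges (blow_up grotzsch_graph B))
    = (\<Sum>i\<in>UNIV. card (B (V i))) * (card (B W) + 2) + 5"
proof -
  \<comment> \<open>Edges at some \<open>V i\<close> point away from it; the edges of the pentagon point forward.\<close>
  define Q where "Q = range (\<lambda>i. (U i, U (i + 1))) \<union> range (\<lambda>i. (V i, U (i - 1)))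
    \<union> range (\<lambda>i. (V i, U (i + 1))) \<union> range (\<lambda>i. (V i, W))"
  have "card (edges (blow_up grotzsch_graph B)) = (\<Sum>(x, y)\<in>Q. card (B x) * card (B y))"
  proof (rule card_edges_blow_up[OF assms(1,2)])
    show "finite Q" by (simp add: Q_def)
    show "{x, y} \<in> edges grotzsch_graph \<longleftrightarrow> (x, y) \<in> Q \<or> (y, x) \<in> Q" for x y
      by (cases x; cases y) (auto simp: Q_def)
    show "(y, x) \<notin> Q" if "(x, y) \<in> Q" for x y
      using that by (auto simp: Q_def add.assoc)
  qed
  also have "\<dots> = 5 + (\<Sum>i\<in>UNIV. card (B (V i))) + (\<Sum>i\<in>UNIV. card (B (V i)))
      + (\<Sum>i\<in>UNIV. card (B (V i))) * card (B W)"
    unfolding Q_def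
    by (subst sum.union_disjoint, simp, simp, force)+
      (simp add: sum.reindex inj_on_def assms(3) sum_distrib_right)
  finally show ?thesis by (simp add: algebra_simps)
qed

lemma card_edges_graph_iso:
  assumes "simple_graph G" "graph_iso G H"
    and H: "\<And>e. e \<in> edges H \<Longrightarrow> \<exists>x\<in>verts H. \<exists>y\<in>verts H. e = {x, y}"
  shows "card (edges G) = card (edges H)"
proof -
  obtain f where f: "bij_betw f (verts G) (verts H)"
    and adj: "\<And>x y. x \<in> verts G \<Longrightarrow> y \<in> verts G \<Longrightarrow> {x, y} \<in> edges G \<longleftrightarrow> {f x, f y} \<in> edges H"
    using assms(2) by (auto simp: graph_iso_def)
  have G: "e \<subseteq> verts G \<and> (\<exists>x\<in>verts G. \<exists>y\<in>verts G. e = {x, y})" if "e \<in> edges G" for e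
    using that assms(1) by (fastforce simp: simple_graph_def nsets_def card_2_iff)
  have "bij_betw ((`) f) (edges G) (edges H)"
  proof (rule bij_betw_imageI)
    show "inj_on ((`) f) (edges G)"
      using G f by (intro inj_on_image inj_on_subset[OF bij_betw_imp_inj_on[OF f]]) blast
    show "(`) f ` edges G = edges H"
    proof
      show "(`) f ` edges G \<subseteq> edges H" using G adj by fastforce
      show "edges H \<subseteq> (`) f ` edges G"
      proof
        fix e assume e: "e \<in> edges H"
        obtain x' y' where "x' \<in> verts H" "y' \<in> verts H" "e = {x', y'}" using H[OF e] by blast
        moreover have "verts H = f ` verts G" using f by (simp add: bij_betw_def)
        ultimately obtain x y where "x \<in> verts G" "y \<in> verts G" "e = {f x, f y}" by auto
        then show "e \<in> (`) f ` edges G" using adj e by (intro image_eqI[of _ _ "{x, y}"]) auto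
      qed
    qed
  qed
  then show ?thesis by (rule bij_betw_same_card)
qed

lemma card_edges_grotzsch_family:
  assumes "simple_graph G" "H \<in> grotzsch_family n" "graph_iso G H"
  shows "int (card (edges G)) = (int n - 3)\<^sup>2 div 4 + 5"
proof -
  obtain B where H: "H = blow_up grotzsch_graph B" and B: "disjoint_family B" "\<And>x. finite (B x)"
    "\<And>i. card (B (U i)) = 1"
    and sizes: "int (\<Sum>i\<in>UNIV. card (B (V i))) = \<lfloor>(real n - 3) / 2\<rfloor> \<and>
        int (card (B W)) = \<lceil>(real n - 7) / 2\<rceil> \<or>
      int (\<Sum>i\<in>UNIV. card (B (V i))) = \<lceil>(real n - 3) / 2\<rceil> \<and>
        int (card (B W)) = \<lfloor>(real n - 7) / 2\<rfloor>"
    using assms(2) unfolding grotzsch_family_def by blast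
  define a where "a = (\<Sum>i\<in>UNIV. card (B (V i)))"
  define r where "r = card (B W)"
  have real: "real n - 3 = real_of_int (int n - 3)" "real n - 7 = real_of_int (int n - 7)" by simp_all
  have "int a = (int n - 3) div 2 \<and> int r = (int n - 6) div 2 \<or>
    int a = (int n - 2) div 2 \<and> int r = (int n - 7) div 2"
    using sizes unfolding a_def[symmetric] r_def[symmetric] real floor_half ceiling_half by simp
  then have s: "int a + int (r + 2) = int n - 3" "\<bar>int a - int (r + 2)\<bar> \<le> 1" by linarith+
  have "int a * int (r + 2) = (int n - 3)\<^sup>2 div 4"
    using mult_le_quarter_square(2)[of "int a" "int (r + 2)", unfolded s(1)] s(2) by blast
  moreover have "card (edges G) = card (edges H)"
  proof (rule card_edges_graph_iso[OF assms(1,3)])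
    show "\<exists>x\<in>verts H. \<exists>y\<in>verts H. e = {x, y}" if "e \<in> edges H" for e
      using that unfolding H blow_up_def grotzsch_graph_def graph.simps by blast
  qed
  moreover have "card (edges H) = a * (r + 2) + 5"
    unfolding H a_def r_def by (rule card_edges_blow_up_grotzsch[OF B])
  ultimately show ?thesis by (simp only: of_nat_add of_nat_mult of_nat_numeral)
qed

section \<open>The theorem\<close>

theorem theorem1p4:
  fixes G :: "'a graph" and n :: nat
  assumes "simple_graph G"
    and "card (verts G) = n"
    and "n \<ge> 90"
    and "triangle_free G"
    and "chromatic_number G \<ge> 4"
  shows "int (card (edges G)) \<le> \<lfloor>(real n - 3)\<^sup>2 / 4\<rfloor> + 5 \<and>
    (int (card (edges G)) = \<lfloor>(real n - 3)\<^sup>2 / 4\<rfloor> + 5 \<longleftrightarrow>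
      (\<exists>H \<in> (grotzsch_family n :: nat graph set). graph_iso G H))"
proof -
  interpret triangle_free_graph G by unfold_locales (fact assms)+
  have not_3col: "\<nexists>c. proper_colouring G 3 c"
    using chromatic_number_le_3I[of G] assms(5) by fastforce
  have floor: "\<lfloor>(real n - 3)\<^sup>2 / 4\<rfloor> = (int n - 3)\<^sup>2 div 4"
    using floor_divide_of_int_eq[of "(int n - 3)\<^sup>2" 4] by simp
  have n10: "n \<ge> 10" using assms(3) by simp
  note bound = edges_bound_or_pentagon[OF not_3col assms(2)[symmetric] n10]
  have "\<exists>H \<in> (grotzsch_family n :: nat graph set). graph_iso G H"
    if eq: "int (card (edges G)) = (int n - 3)\<^sup>2 div 4 + 5"
  proof -
    obtain u :: "5 \<Rightarrow> 'a" and A R where split: "verts G = range u \<union> A \<union> R"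
      "range u \<inter> A = {}" "range u \<inter> R = {}" "A \<inter> R = {}" "\<forall>i. adj (u i) (u (i + 1))"
      "\<forall>a\<in>A. \<forall>b\<in>A. \<not> adj a b" "\<forall>x\<in>R. \<forall>y\<in>R. \<not> adj x y"
      "\<forall>a\<in>A. card (nbhd a \<inter> range u) = 2"
      and deg: "\<forall>x\<in>R. card (nbhd x) = card A"
      and balanced: "\<bar>int (card A) - int (card R + 2)\<bar> \<le> 1"
      using bound(2)[OF eq] by blast
    interpret pentagon_split G u A R
    proof
      show "adj (u i) (u (i + 1))" for i using split(5) by blast
      show "\<not> adj a b" if "a \<in> A" "b \<in> A" for a b using split(6) that by blast
      show "\<not> adj x y" if "x \<in> R" "y \<in> R" for x y using split(7) that by blast
      show "card (nbhd a \<inter> range u) = 2" if "a \<in> A" for a using split(8) that by blast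
    qed (rule split(1-4) not_3col)+
    have "card A > 10" using card_verts assms(2,3) balanced by linarith
    then show ?thesis
      using graph_iso_grotzsch_family_extremal deg balanced assms(2) by simp
  qed
  then show ?thesis
    using bound(1) card_edges_grotzsch_family[OF assms(1)] unfolding floor by blast
qed

end
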